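(* Let $S=k[x_1,\ldots,x_d]$ be a standard graded polynomial ring over a field $k$ of characteristic zero. Let $I\subseteq J$ be graded ideals of $S$ such that $\partial(I)\subseteq J$, where $\partial(I)$ is the ideal generated by all partial derivatives $\partial f/\partial x_i$ with $f\in I$ and $i=1,\ldots,d$. Then the map $\operatorname{Tor}^S_i(S/I,k)\to\operatorname{Tor}^S_i(S/J,k)$ induced by the natural surjection $S/I\to S/J$ is zero for all $i>0$. In particular, $\rho(I)=1$ for every proper graded ideal $I$ of $S$.
   Context: Definition of $\rho(I)$: for a proper graded ideal $I$ of $S$, $\rho(I)$ is the smallest positive integer $m$ such that for all $r>m$ and all $i>0$ the map $\operatorname{Tor}^S_i(S/I^r,k)\to\operatorname{Tor}^S_i(S/I^{r-1},k)$ induced by the natural surjection $S/I^r\to S/I^{r-1}$ is zero. (Such an integer always exists.) Here $k=S/(x_1,\ldots,x_d)$. *)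

theory Defs
  imports "HOL-Algebra.Algebra" "HOL-Algebra.Free_Abelian_Groups" "HOL-Library.Poly_Mapping"
begin

section \<open>Modules, free resolutions and Tor over a commutative ring\<close>

definition module_hom ::
  "('a, 'r) ring_scheme \<Rightarrow> ('a, 'b, 'm) module_scheme \<Rightarrow> ('a, 'c, 'n) module_scheme \<Rightarrow> ('b \<Rightarrow> 'c) set"
  where "module_hom R M N =
    {h \<in> hom (add_monoid M) (add_monoid N).
       \<forall>r\<in>carrier R. \<forall>x\<in>carrier M. h (r \<odot>\<^bsub>M\<^esub> x) = r \<odot>\<^bsub>N\<^esub> h x}"

definition free_module :: "('a, 'r) ring_scheme \<Rightarrow> ('a, 'b, 'm) module_scheme \<Rightarrow> bool"
  where "free_module R M \<longleftrightarrow> module R M \<and>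
    (\<exists>B\<subseteq>carrier M. \<forall>x\<in>carrier M.
       \<exists>!a. (\<forall>b\<in>B. a b \<in> carrier R) \<and> (\<forall>b. b \<notin> B \<longrightarrow> a b = \<zero>\<^bsub>R\<^esub>)
          \<and> finite {b. a b \<noteq> \<zero>\<^bsub>R\<^esub>}
          \<and> x = (\<Oplus>\<^bsub>M\<^esub> b\<in>{b. a b \<noteq> \<zero>\<^bsub>R\<^esub>}. a b \<odot>\<^bsub>M\<^esub> b))"

text \<open>The complex \<open>\<dots> \<rightarrow> P 2 \<rightarrow> P 1 \<rightarrow> P 0 \<rightarrow> N \<rightarrow> 0\<close> is exact and all \<open>P n\<close> are free. The
  differential \<open>\<delta> n\<close> goes from \<open>P (Suc n)\<close> to \<open>P n\<close>, and \<open>\<epsilon>\<close> is the augmentation.\<close>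

definition free_resolution ::
  "('a, 'r) ring_scheme \<Rightarrow> ('a, 'b, 'm) module_scheme \<Rightarrow> (nat \<Rightarrow> ('a, 'c) module) \<Rightarrow>
   (nat \<Rightarrow> 'c \<Rightarrow> 'c) \<Rightarrow> ('c \<Rightarrow> 'b) \<Rightarrow> bool"
  where "free_resolution R N P \<delta> \<epsilon> \<longleftrightarrow>
    (\<forall>n. free_module R (P n)) \<and>
    (\<forall>n. \<delta> n \<in> module_hom R (P (Suc n)) (P n)) \<and>
    \<epsilon> \<in> module_hom R (P 0) N \<and>
    \<epsilon> ` carrier (P 0) = carrier N \<and>
    a_kernel (P 0) N \<epsilon> = \<delta> 0 ` carrier (P (Suc 0)) \<and>
    (\<forall>n. a_kernel (P (Suc n)) (P n) (\<delta> n) = \<delta> (Suc n) ` carrier (P (Suc (Suc n))))"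

text \<open>\<open>M \<otimes>\<^sub>R N\<close> is built as an abelian group: the free abelian group on \<open>M \<times> N\<close> modulo the
  bilinearity relations. Its \<open>R\<close>-module structure is not needed to say that a map is zero.\<close>

definition tensor_free ::
  "('a, 'b, 'm) module_scheme \<Rightarrow> ('a, 'c, 'n) module_scheme \<Rightarrow> ('b \<times> 'c \<Rightarrow>\<^sub>0 int) monoid"
  where "tensor_free M N = free_Abelian_group (carrier M \<times> carrier N)"

definition tensor_relations ::
  "('a, 'r) ring_scheme \<Rightarrow> ('a, 'b, 'm) module_scheme \<Rightarrow> ('a, 'c, 'n) module_scheme \<Rightarrow>
   ('b \<times> 'c \<Rightarrow>\<^sub>0 int) set"
  where "tensor_relations R M N = generate (tensor_free M N)
    ({frag_of (x \<oplus>\<^bsub>M\<^esub> x', y) - frag_of (x, y) - frag_of (x', y) | x x' y.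
        x \<in> carrier M \<and> x' \<in> carrier M \<and> y \<in> carrier N} \<union>
     {frag_of (x, y \<oplus>\<^bsub>N\<^esub> y') - frag_of (x, y) - frag_of (x, y') | x y y'.
        x \<in> carrier M \<and> y \<in> carrier N \<and> y' \<in> carrier N} \<union>
     {frag_of (r \<odot>\<^bsub>M\<^esub> x, y) - frag_of (x, r \<odot>\<^bsub>N\<^esub> y) | r x y.
        r \<in> carrier R \<and> x \<in> carrier M \<and> y \<in> carrier N})"

definition tensor_product ::
  "('a, 'r) ring_scheme \<Rightarrow> ('a, 'b, 'm) module_scheme \<Rightarrow> ('a, 'c, 'n) module_scheme \<Rightarrow>
   ('b \<times> 'c \<Rightarrow>\<^sub>0 int) set monoid"
  where "tensor_product R M N = tensor_free M N Mod tensor_relations R M N"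

text \<open>The map \<open>f \<otimes> g\<close> into \<open>M' \<otimes> N'\<close>. Maps out of quotient groups are given here and below by
  the union over all representatives; for homomorphisms all members of the union coincide.\<close>

definition tensor_map ::
  "('a, 'r) ring_scheme \<Rightarrow> ('a, 'b, 'm) module_scheme \<Rightarrow> ('a, 'c, 'n) module_scheme \<Rightarrow>
   ('b' \<Rightarrow> 'b) \<Rightarrow> ('c' \<Rightarrow> 'c) \<Rightarrow> ('b' \<times> 'c' \<Rightarrow>\<^sub>0 int) set \<Rightarrow> ('b \<times> 'c \<Rightarrow>\<^sub>0 int) set"
  where "tensor_map R M' N' f g C =
    (\<Union>c\<in>C. tensor_relations R M' N' #>\<^bsub>tensor_free M' N'\<^esub>
       frag_extend (\<lambda>(x, y). frag_of (f x, g y)) c)"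

text \<open>Homology of a complex of abelian groups \<open>\<dots> \<rightarrow> T 1 \<rightarrow> T 0 \<rightarrow> 0\<close> with differentials
  \<open>D n\<close> from \<open>T (Suc n)\<close> to \<open>T n\<close>.\<close>

definition cycles :: "(nat \<Rightarrow> 'a monoid) \<Rightarrow> (nat \<Rightarrow> 'a \<Rightarrow> 'a) \<Rightarrow> nat \<Rightarrow> 'a set"
  where "cycles T D n = (case n of 0 \<Rightarrow> carrier (T 0) | Suc m \<Rightarrow> kernel (T (Suc m)) (T m) (D m))"

definition boundaries :: "(nat \<Rightarrow> 'a monoid) \<Rightarrow> (nat \<Rightarrow> 'a \<Rightarrow> 'a) \<Rightarrow> nat \<Rightarrow> 'a set"
  where "boundaries T D n = D n ` carrier (T (Suc n))"

definition homology :: "(nat \<Rightarrow> 'a monoid) \<Rightarrow> (nat \<Rightarrow> 'a \<Rightarrow> 'a) \<Rightarrow> nat \<Rightarrow> 'a set monoid"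
  where "homology T D n = (T n)\<lparr>carrier := cycles T D n\<rparr> Mod boundaries T D n"

definition homology_map ::
  "(nat \<Rightarrow> 'b monoid) \<Rightarrow> (nat \<Rightarrow> 'b \<Rightarrow> 'b) \<Rightarrow> (nat \<Rightarrow> 'a \<Rightarrow> 'b) \<Rightarrow> nat \<Rightarrow> 'a set \<Rightarrow> 'b set"
  where "homology_map T' D' f n C = (\<Union>z\<in>C. boundaries T' D' n #>\<^bsub>T' n\<^esub> f n z)"

text \<open>If \<open>(P, \<delta>)\<close> is a free resolution of \<open>N\<close>, then \<open>Tor R M P \<delta> i\<close> is \<open>Tor\<^sub>i(M, N)\<close>, the homology
  of \<open>M \<otimes> P\<close>. As usual, this depends on the choice of \<open>(P, \<delta>)\<close> only up to an isomorphism
  that is natural in \<open>M\<close>.\<close>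

definition Tor ::
  "('a, 'r) ring_scheme \<Rightarrow> ('a, 'b, 'm) module_scheme \<Rightarrow> (nat \<Rightarrow> ('a, 'c) module) \<Rightarrow>
   (nat \<Rightarrow> 'c \<Rightarrow> 'c) \<Rightarrow> nat \<Rightarrow> ('b \<times> 'c \<Rightarrow>\<^sub>0 int) set set monoid"
  where "Tor R M P \<delta> i =
    homology (\<lambda>n. tensor_product R M (P n)) (\<lambda>n. tensor_map R M (P n) id (\<delta> n)) i"

text \<open>The map \<open>Tor\<^sub>i(M, N) \<rightarrow> Tor\<^sub>i(M', N)\<close> induced by \<open>f : M \<rightarrow> M'\<close>.\<close>

definition Tor_map ::
  "('a, 'r) ring_scheme \<Rightarrow> ('a, 'b, 'm) module_scheme \<Rightarrow> (nat \<Rightarrow> ('a, 'c) module) \<Rightarrow>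
   (nat \<Rightarrow> 'c \<Rightarrow> 'c) \<Rightarrow> ('b' \<Rightarrow> 'b) \<Rightarrow> nat \<Rightarrow>
   ('b' \<times> 'c \<Rightarrow>\<^sub>0 int) set set \<Rightarrow> ('b \<times> 'c \<Rightarrow>\<^sub>0 int) set set"
  where "Tor_map R M' P \<delta> f i =
    homology_map (\<lambda>n. tensor_product R M' (P n)) (\<lambda>n. tensor_map R M' (P n) id (\<delta> n))
      (\<lambda>n. tensor_map R M' (P n) f id) i"

definition zero_map :: "('a, 'm) monoid_scheme \<Rightarrow> ('b, 'n) monoid_scheme \<Rightarrow> ('a \<Rightarrow> 'b) \<Rightarrow> bool"
  where "zero_map G H f \<longleftrightarrow> (\<forall>x\<in>carrier G. f x = \<one>\<^bsub>H\<^esub>)"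

text \<open>\<open>R / I\<close> as an \<open>R\<close>-module; the other fields are those of \<open>R Quot I\<close>.\<close>

definition quot_module :: "('a, 'r) ring_scheme \<Rightarrow> 'a set \<Rightarrow> ('a, 'a set) module"
  where "quot_module R I =
    \<lparr>carrier = a_rcosets\<^bsub>R\<^esub> I, monoid.mult = rcoset_mult R I, one = I +>\<^bsub>R\<^esub> \<one>\<^bsub>R\<^esub>,
     ring.zero = I, ring.add = set_add R, smult = (\<lambda>r C. rcoset_mult R I (I +>\<^bsub>R\<^esub> r) C)\<rparr>"

definition quot_proj :: "('a, 'r) ring_scheme \<Rightarrow> 'a set \<Rightarrow> 'a set \<Rightarrow> 'a set"
  where "quot_proj R J C = (\<Union>x\<in>C. J +>\<^bsub>R\<^esub> x)"


section \<open>The standard graded polynomial ring\<close>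

text \<open>Monomials are exponent vectors \<open>nat \<Rightarrow>\<^sub>0 nat\<close>, and \<open>k[x\<^sub>1, \<dots>, x\<^sub>d]\<close> consists of the
  polynomials in which only the variables with index in \<open>{1..d}\<close> occur.\<close>

type_synonym 'k mpoly = "(nat \<Rightarrow>\<^sub>0 nat) \<Rightarrow>\<^sub>0 'k"

definition mpoly_ring :: "nat \<Rightarrow> ('k::field) mpoly ring"
  where "mpoly_ring d =
    \<lparr>carrier = {p. \<forall>m\<in>Poly_Mapping.keys p. Poly_Mapping.keys m \<subseteq> {1..d}},
     monoid.mult = (*), one = 1, ring.zero = 0, ring.add = (+)\<rparr>"

definition mvar :: "nat \<Rightarrow> ('k::field) mpoly"
  where "mvar j = Poly_Mapping.single (Poly_Mapping.single j 1) 1"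

definition monom_deg :: "(nat \<Rightarrow>\<^sub>0 nat) \<Rightarrow> nat"
  where "monom_deg m = (\<Sum>j\<in>Poly_Mapping.keys m. Poly_Mapping.lookup m j)"

definition hom_component :: "nat \<Rightarrow> ('k::field) mpoly \<Rightarrow> 'k mpoly"
  where "hom_component n p =
    (\<Sum>m\<in>{m \<in> Poly_Mapping.keys p. monom_deg m = n}.
       Poly_Mapping.single m (Poly_Mapping.lookup p m))"

definition graded_ideal :: "nat \<Rightarrow> ('k::field) mpoly set \<Rightarrow> bool"
  where "graded_ideal d I \<longleftrightarrow>
    ideal I (mpoly_ring d) \<and> (\<forall>f\<in>I. \<forall>n. hom_component n f \<in> I)"

definition partial_deriv :: "nat \<Rightarrow> ('k::field) mpoly \<Rightarrow> 'k mpoly"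
  where "partial_deriv j p =
    (\<Sum>m\<in>Poly_Mapping.keys p.
       Poly_Mapping.single (m - Poly_Mapping.single j 1)
         (of_nat (Poly_Mapping.lookup m j) * Poly_Mapping.lookup p m))"

definition deriv_ideal :: "nat \<Rightarrow> ('k::field) mpoly set \<Rightarrow> 'k mpoly set"
  where "deriv_ideal d I = Idl\<^bsub>mpoly_ring d\<^esub> {partial_deriv j f | j f. j \<in> {1..d} \<and> f \<in> I}"

definition residue_module :: "nat \<Rightarrow> (('k::field) mpoly, 'k mpoly set) module"
  where "residue_module d = quot_module (mpoly_ring d) (Idl\<^bsub>mpoly_ring d\<^esub> (mvar ` {1..d}))"

text \<open>For \<open>I \<subseteq> J\<close> and a free resolution \<open>(P, \<delta>)\<close> of the residue field: the map
  \<open>Tor\<^sub>i(S/I, k) \<rightarrow> Tor\<^sub>i(S/J, k)\<close> induced by the natural surjection is zero.\<close>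

definition Tor_surj_zero ::
  "nat \<Rightarrow> (nat \<Rightarrow> (('k::field) mpoly, 'c) module) \<Rightarrow> (nat \<Rightarrow> 'c \<Rightarrow> 'c) \<Rightarrow>
   'k mpoly set \<Rightarrow> 'k mpoly set \<Rightarrow> nat \<Rightarrow> bool"
  where "Tor_surj_zero d P \<delta> I J i \<longleftrightarrow>
    zero_map (Tor (mpoly_ring d) (quot_module (mpoly_ring d) I) P \<delta> i)
             (Tor (mpoly_ring d) (quot_module (mpoly_ring d) J) P \<delta> i)
             (Tor_map (mpoly_ring d) (quot_module (mpoly_ring d) J) P \<delta> (quot_proj (mpoly_ring d) J) i)"

definition rho ::
  "nat \<Rightarrow> (nat \<Rightarrow> (('k::field) mpoly, 'c) module) \<Rightarrow> (nat \<Rightarrow> 'c \<Rightarrow> 'c) \<Rightarrow> 'k mpoly set \<Rightarrow> nat"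
  where "rho d P \<delta> I = (LEAST m. 0 < m \<and>
    (\<forall>r>m. \<forall>i>0. Tor_surj_zero d P \<delta>
       (I [^]\<^bsub>ideals_set (mpoly_ring d)\<^esub> r) (I [^]\<^bsub>ideals_set (mpoly_ring d)\<^esub> (r - 1)) i))"

end

theory Submission
  imports Defs
begin

text \<open>
  Tor is computed from a resolution of the residue field, and for that resolution the Koszul complex
  is the best choice: its chains are the polynomial differential forms on affine space, and its
  differential \<open>\<iota>\<close> is contraction with the Euler vector field. Together with the exterior
  derivative \<open>d\<close> it satisfies Cartan's formula: \<open>\<iota> d + d \<iota>\<close> multiplies a form by its total
  degree (\<open>cartan_formula\<close>, \<open>euler_formula\<close>). Now let \<open>w\<close> be homogeneous of total degree
  \<open>n > 0\<close> and a cycle modulo \<open>I\<close>, that is, \<open>\<iota> w\<close> has coefficients in \<open>I\<close>. The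
  coefficients of \<open>d \<iota> w\<close> are combinations of derivatives of elements of \<open>I\<close>, hence lie in
  \<open>J\<close>, and \<open>n w = \<iota> d w + d \<iota> w\<close> shows that \<open>w\<close> is a boundary modulo \<open>J\<close>, as
  \<open>n\<close> is invertible in characteristic zero. Graded ideals allow the reduction to homogeneous
  forms. This is \<open>koszul_relative_boundary\<close>. The same argument with \<open>I = J = 0\<close> proves that the
  Koszul complex is exact (\<open>koszul_resolution\<close>).

  The given free resolution \<open>P\<close> of the residue field is arbitrary and need not be graded or of
  finite rank, so the result has to be carried over. Comparison maps between \<open>P\<close> and the Koszul
  complex, in both directions, and a homotopy from their composite to the identity of \<open>P\<close> show
  that chains of \<open>P\<close> with boundary in \<open>I P\<close> are boundaries modulo \<open>J P\<close>
  (\<open>relative_boundary_transfer\<close>). Finally \<open>S/I \<otimes> P\<close> is \<open>P/IP\<close> by way of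
  \<open>p \<mapsto> 1 \<otimes> p\<close> (\<open>one_tensor_surj\<close>, \<open>one_tensor_eq_iff\<close>), so this is precisely the
  vanishing of the map on Tor (\<open>Tor_map_zero\<close>).

  By the product rule all derivatives of elements of \<open>I\<^sup>r\<close> lie in the power with exponent
  \<open>r - 1\<close> (\<open>partial_deriv_ideal_pow\<close>), and powers of graded ideals are graded. So the
  condition that defines \<open>\<rho>(I)\<close> holds for the smallest positive integer.
\<close>

section \<open>Module homomorphisms and coordinates\<close>

lemma module_homI:
  assumes "\<And>x. x \<in> carrier M \<Longrightarrow> h x \<in> carrier N"
    and "\<And>x y. \<lbrakk>x \<in> carrier M; y \<in> carrier M\<rbrakk> \<Longrightarrow> h (x \<oplus>\<^bsub>M\<^esub> y) = h x \<oplus>\<^bsub>N\<^esub> h y"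
    and "\<And>r x. \<lbrakk>r \<in> carrier R; x \<in> carrier M\<rbrakk> \<Longrightarrow> h (r \<odot>\<^bsub>M\<^esub> x) = r \<odot>\<^bsub>N\<^esub> h x"
  shows "h \<in> module_hom R M N"
  using assms by (auto simp: module_hom_def hom_def)

lemma module_homD:
  assumes "h \<in> module_hom R M N"
  shows module_hom_closed: "x \<in> carrier M \<Longrightarrow> h x \<in> carrier N"
    and module_hom_add: "\<lbrakk>x \<in> carrier M; y \<in> carrier M\<rbrakk> \<Longrightarrow> h (x \<oplus>\<^bsub>M\<^esub> y) = h x \<oplus>\<^bsub>N\<^esub> h y"
    and module_hom_smult: "\<lbrakk>r \<in> carrier R; x \<in> carrier M\<rbrakk> \<Longrightarrow> h (r \<odot>\<^bsub>M\<^esub> x) = r \<odot>\<^bsub>N\<^esub> h x"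
  using assms by (auto simp: module_hom_def hom_def)

lemma module_hom_zero:
  assumes "module R M" "module R N" "h \<in> module_hom R M N"
  shows "h \<zero>\<^bsub>M\<^esub> = \<zero>\<^bsub>N\<^esub>"
proof -
  interpret M: module R M by fact
  interpret N: module R N by fact
  have "h (\<zero>\<^bsub>R\<^esub> \<odot>\<^bsub>M\<^esub> \<zero>\<^bsub>M\<^esub>) = \<zero>\<^bsub>R\<^esub> \<odot>\<^bsub>N\<^esub> h \<zero>\<^bsub>M\<^esub>"
    using module_hom_smult[OF assms(3) M.R.zero_closed M.zero_closed] .
  then show ?thesis using module_hom_closed[OF assms(3)] by simp
qed

lemma module_hom_a_inv:
  assumes "module R M" "module R N" "h \<in> module_hom R M N" "x \<in> carrier M"
  shows "h (\<ominus>\<^bsub>M\<^esub> x) = \<ominus>\<^bsub>N\<^esub> h x"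
proof -
  interpret M: module R M by fact
  interpret N: module R N by fact
  have "h x \<oplus>\<^bsub>N\<^esub> h (\<ominus>\<^bsub>M\<^esub> x) = \<zero>\<^bsub>N\<^esub>"
    using assms by (simp add: module_hom_add[symmetric] M.r_neg module_hom_zero)
  then show ?thesis using assms module_hom_closed[OF assms(3)]
    by (metis M.a_inv_closed N.minus_equality N.a_comm)
qed

lemma module_hom_minus:
  assumes "module R M" "module R N" "h \<in> module_hom R M N" "x \<in> carrier M" "y \<in> carrier M"
  shows "h (x \<ominus>\<^bsub>M\<^esub> y) = h x \<ominus>\<^bsub>N\<^esub> h y"
proof -
  interpret M: module R M by fact
  interpret N: module R N by fact
  show ?thesis using assms by (simp add: a_minus_def module_hom_add module_hom_a_inv)
qed

lemma module_hom_comp: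
  assumes "g \<in> module_hom R M N" "f \<in> module_hom R L M"
  shows "(\<lambda>x. g (f x)) \<in> module_hom R L N"
  by (rule module_homI) (simp_all add: module_homD[OF assms(1)] module_homD[OF assms(2)])

lemma module_hom_id: "(\<lambda>x. x) \<in> module_hom R M M"
  by (simp add: module_homI)

lemma (in abelian_group) minus_self [simp]: "x \<in> carrier G \<Longrightarrow> x \<ominus> x = \<zero>"
  by (simp add: a_minus_def r_neg)

lemma (in abelian_group) minus_zero_right: "x \<in> carrier G \<Longrightarrow> x \<ominus> \<zero> = x"
  using minus_equality[of \<zero> \<zero>] by (simp add: a_minus_def)

lemma (in module) minus_add_distrib:
  assumes "a \<in> carrier M" "b \<in> carrier M" "c \<in> carrier M" "d \<in> carrier M"
  shows "(a \<oplus>\<^bsub>M\<^esub> b) \<ominus>\<^bsub>M\<^esub> (c \<oplus>\<^bsub>M\<^esub> d) = (a \<ominus>\<^bsub>M\<^esub> c) \<oplus>\<^bsub>M\<^esub> (b \<ominus>\<^bsub>M\<^esub> d)"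
  using assms by (simp add: a_minus_def M.minus_add M.a_ac)

text \<open>The cancellation that combines a homotopy with a boundary in
  \<open>relative_boundary_transfer\<close>.\<close>

lemma (in module) minus_telescope:
  assumes "p \<in> carrier M" "t \<in> carrier M" "u \<in> carrier M" "r \<in> carrier M"
  shows "p \<ominus>\<^bsub>M\<^esub> (t \<oplus>\<^bsub>M\<^esub> (p \<ominus>\<^bsub>M\<^esub> u \<ominus>\<^bsub>M\<^esub> r)) = (u \<ominus>\<^bsub>M\<^esub> t) \<oplus>\<^bsub>M\<^esub> r"
proof -
  define w where "w = p \<ominus>\<^bsub>M\<^esub> u \<ominus>\<^bsub>M\<^esub> r"
  have w: "w \<in> carrier M" using assms by (simp add: w_def)
  have "w \<oplus>\<^bsub>M\<^esub> r = p \<ominus>\<^bsub>M\<^esub> u"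
    using assms by (simp add: w_def a_minus_def M.a_assoc M.l_neg)
  then have "u \<oplus>\<^bsub>M\<^esub> (r \<oplus>\<^bsub>M\<^esub> w) = u \<oplus>\<^bsub>M\<^esub> (p \<ominus>\<^bsub>M\<^esub> u)"
    using assms w by (simp add: M.a_comm)
  also have "\<dots> = p \<ominus>\<^bsub>M\<^esub> u \<oplus>\<^bsub>M\<^esub> u"
    using assms by (intro M.a_comm) simp_all
  also have "\<dots> = p" using assms by (simp add: a_minus_def M.a_assoc M.l_neg)
  finally have "p = (u \<oplus>\<^bsub>M\<^esub> r) \<oplus>\<^bsub>M\<^esub> w" using assms w by (simp add: M.a_assoc)
  then have "p \<ominus>\<^bsub>M\<^esub> (t \<oplus>\<^bsub>M\<^esub> w) = (u \<oplus>\<^bsub>M\<^esub> r \<ominus>\<^bsub>M\<^esub> t) \<oplus>\<^bsub>M\<^esub> (w \<ominus>\<^bsub>M\<^esub> w)"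
    using assms w by (simp add: minus_add_distrib)
  also have "\<dots> = u \<oplus>\<^bsub>M\<^esub> (r \<oplus>\<^bsub>M\<^esub> \<ominus>\<^bsub>M\<^esub> t)"
    using assms w by (simp add: a_minus_def M.a_assoc M.r_neg)
  also have "\<dots> = (u \<ominus>\<^bsub>M\<^esub> t) \<oplus>\<^bsub>M\<^esub> r"
    using assms by (simp add: a_minus_def M.a_assoc M.a_comm[of r])
  finally show ?thesis by (simp add: w_def)
qed

lemma module_hom_diff:
  assumes "module R N" "f \<in> module_hom R M N" "g \<in> module_hom R M N"
  shows "(\<lambda>x. f x \<ominus>\<^bsub>N\<^esub> g x) \<in> module_hom R M N"
proof -
  interpret N: module R N by fact
  show ?thesis
  proof (rule module_homI)
    fix r x assume "r \<in> carrier R" "x \<in> carrier M"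
    then show "f (r \<odot>\<^bsub>M\<^esub> x) \<ominus>\<^bsub>N\<^esub> g (r \<odot>\<^bsub>M\<^esub> x) = r \<odot>\<^bsub>N\<^esub> (f x \<ominus>\<^bsub>N\<^esub> g x)"
      by (simp add: module_homD[OF assms(2)] module_homD[OF assms(3)] a_minus_def
          N.smult_r_distr N.smult_r_minus)
  qed (simp_all add: module_homD[OF assms(2)] module_homD[OF assms(3)] N.minus_add_distrib)
qed

lemma (in module) smult_module_hom:
  assumes "r \<in> carrier R" shows "(\<lambda>x. r \<odot>\<^bsub>M\<^esub> x) \<in> module_hom R M M"
proof (rule module_homI)
  fix s x assume "s \<in> carrier R" "x \<in> carrier M"
  then show "r \<odot>\<^bsub>M\<^esub> (s \<odot>\<^bsub>M\<^esub> x) = s \<odot>\<^bsub>M\<^esub> (r \<odot>\<^bsub>M\<^esub> x)"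
    using assms by (metis R.m_comm smult_assoc1)
qed (use assms in \<open>simp_all add: smult_r_distr\<close>)

text \<open>The index set is the whole type and only finitely many summands are nonzero. This avoids a
  separate index set for every element in the additivity statements that follow.\<close>

abbreviation lincomb :: "('a, 'b, 'm) module_scheme \<Rightarrow> ('i \<Rightarrow> 'a) \<Rightarrow> ('i \<Rightarrow> 'b) \<Rightarrow> 'b"
  where "lincomb M a y \<equiv> gfinprod (add_monoid M) (\<lambda>i. a i \<odot>\<^bsub>M\<^esub> y i) UNIV"

lemma (in abelian_group) gfinprod_eq_finsum:
  assumes "finite S" "\<And>i. i \<notin> S \<Longrightarrow> f i = \<zero>" "\<And>i. f i \<in> carrier G"
  shows "gfinprod (add_monoid G) f UNIV = finsum G f S"
proof -
  interpret A: comm_group "add_monoid G" by (rule a_comm_group)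
  have sub: "{i. f i \<noteq> \<zero>} \<subseteq> S" using assms(2) by auto
  then have "finite {i. f i \<noteq> \<zero>}" using assms(1) finite_subset by auto
  then have "gfinprod (add_monoid G) f UNIV = finsum G f {i. f i \<noteq> \<zero>}"
    by (simp add: gfinprod_def finsum_def)
  also have "\<dots> = finsum G f S"
    by (rule add.finprod_mono_neutral_cong_left) (use sub assms in auto)
  finally show ?thesis .
qed

lemma module_hom_gfinprod:
  assumes "module R M" "module R N" and h: "h \<in> module_hom R M N"
    and fin: "finite S" "\<And>i. i \<notin> S \<Longrightarrow> f i = \<zero>\<^bsub>M\<^esub>" and f: "\<And>i. f i \<in> carrier M"
  shows "h (gfinprod (add_monoid M) f UNIV) = gfinprod (add_monoid N) (\<lambda>i. h (f i)) UNIV"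
proof -
  interpret M: module R M by fact
  interpret N: module R N by fact
  have "h (finsum M f S) = finsum N (\<lambda>i. h (f i)) S"
    using fin(1)
  proof (induction S)
    case (insert s S)
    then show ?case
      using f module_hom_closed[OF h] by (simp add: M.finsum_insert N.finsum_insert module_hom_add[OF h] Pi_iff)
  qed (simp add: module_hom_zero[OF assms(1-3)])
  moreover have "gfinprod (add_monoid M) f UNIV = finsum M f S"
    by (rule M.gfinprod_eq_finsum) (use fin f in auto)
  moreover have "gfinprod (add_monoid N) (\<lambda>i. h (f i)) UNIV = finsum N (\<lambda>i. h (f i)) S"
    by (rule N.gfinprod_eq_finsum) (use fin f module_hom_closed[OF h] in \<open>auto simp: module_hom_zero[OF assms(1-3)]\<close>)
  ultimately show ?thesis by simp
qed

lemma (in module) lincomb_eq_finsum: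
  assumes "finite S" "\<And>i. i \<notin> S \<Longrightarrow> a i = \<zero>" "\<And>i. a i \<in> carrier R" "\<And>i. y i \<in> carrier M"
  shows "lincomb M a y = (\<Oplus>\<^bsub>M\<^esub> i\<in>S. a i \<odot>\<^bsub>M\<^esub> y i)"
  by (rule M.gfinprod_eq_finsum) (use assms in auto)

lemma (in module) lincomb_closed:
  assumes "\<And>i. a i \<in> carrier R" "\<And>i. y i \<in> carrier M"
  shows "lincomb M a y \<in> carrier M"
  using comm_monoid.gfinprod_closed[OF M.a_comm_monoid, of "\<lambda>i. a i \<odot>\<^bsub>M\<^esub> y i" UNIV] assms
  by (simp add: Pi_iff)

lemma (in module) lincomb_add:
  assumes "finite {i. a i \<noteq> \<zero>}" "finite {i. b i \<noteq> \<zero>}"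
    and "\<And>i. a i \<in> carrier R" "\<And>i. b i \<in> carrier R" "\<And>i. y i \<in> carrier M"
  shows "lincomb M (\<lambda>i. a i \<oplus> b i) y = lincomb M a y \<oplus>\<^bsub>M\<^esub> lincomb M b y"
proof -
  let ?S = "{i. a i \<noteq> \<zero>} \<union> {i. b i \<noteq> \<zero>}"
  have "lincomb M (\<lambda>i. a i \<oplus> b i) y = (\<Oplus>\<^bsub>M\<^esub> i\<in>?S. (a i \<oplus> b i) \<odot>\<^bsub>M\<^esub> y i)"
    by (rule lincomb_eq_finsum) (use assms in auto)
  also have "\<dots> = (\<Oplus>\<^bsub>M\<^esub> i\<in>?S. a i \<odot>\<^bsub>M\<^esub> y i \<oplus>\<^bsub>M\<^esub> b i \<odot>\<^bsub>M\<^esub> y i)"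
    by (rule M.finsum_cong') (use assms in \<open>auto simp: smult_l_distr\<close>)
  also have "\<dots> = (\<Oplus>\<^bsub>M\<^esub> i\<in>?S. a i \<odot>\<^bsub>M\<^esub> y i) \<oplus>\<^bsub>M\<^esub> (\<Oplus>\<^bsub>M\<^esub> i\<in>?S. b i \<odot>\<^bsub>M\<^esub> y i)"
    by (rule M.finsum_addf) (use assms in auto)
  also have "(\<Oplus>\<^bsub>M\<^esub> i\<in>?S. a i \<odot>\<^bsub>M\<^esub> y i) = lincomb M a y"
    by (rule lincomb_eq_finsum[symmetric]) (use assms in auto)
  also have "(\<Oplus>\<^bsub>M\<^esub> i\<in>?S. b i \<odot>\<^bsub>M\<^esub> y i) = lincomb M b y"
    by (rule lincomb_eq_finsum[symmetric]) (use assms in auto)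
  finally show ?thesis .
qed

lemma module_hom_lincomb:
  assumes "module R M" "module R N" and h: "h \<in> module_hom R M N"
    and "finite {i. a i \<noteq> \<zero>\<^bsub>R\<^esub>}" "\<And>i. a i \<in> carrier R" "\<And>i. y i \<in> carrier M"
  shows "h (lincomb M a y) = lincomb N a (\<lambda>i. h (y i))"
proof -
  interpret M: module R M by fact
  show ?thesis
    using module_hom_gfinprod[OF assms(1-4), of "\<lambda>i. a i \<odot>\<^bsub>M\<^esub> y i"] assms(5,6)
    by (simp add: module_hom_smult[OF h])
qed

lemma (in module) lincomb_smult:
  assumes "finite {i. a i \<noteq> \<zero>}" "\<And>i. a i \<in> carrier R" "\<And>i. y i \<in> carrier M" "r \<in> carrier R"
  shows "lincomb M (\<lambda>i. r \<otimes> a i) y = r \<odot>\<^bsub>M\<^esub> lincomb M a y"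
proof -
  have "r \<odot>\<^bsub>M\<^esub> lincomb M a y = gfinprod (add_monoid M) (\<lambda>i. r \<odot>\<^bsub>M\<^esub> (a i \<odot>\<^bsub>M\<^esub> y i)) UNIV"
    by (rule module_hom_gfinprod[OF _ _ smult_module_hom, where S="{i. a i \<noteq> \<zero>}"])
       (use assms module_axioms in auto)
  then show ?thesis using assms by (simp add: smult_assoc1)
qed

text \<open>The dual basis description of a projective module: generators \<open>e i\<close> together with linear
  coordinate functions \<open>c i\<close>. Linearity of the coordinates is what makes it easy to define
  homomorphisms by their values on generators, and the Koszul modules have such coordinates on the
  nose. Some \<open>e i\<close> may be zero, so that the index type can be larger than a basis.\<close>

definition dual_basis ::
  "('a, 'r) ring_scheme \<Rightarrow> ('a, 'b, 'm) module_scheme \<Rightarrow> ('i \<Rightarrow> 'b) \<Rightarrow> ('i \<Rightarrow> 'b \<Rightarrow> 'a) \<Rightarrow> bool"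
  where "dual_basis R M e c \<longleftrightarrow>
    (\<forall>i. e i \<in> carrier M) \<and>
    (\<forall>x\<in>carrier M. (\<forall>i. c i x \<in> carrier R) \<and> finite {i. c i x \<noteq> \<zero>\<^bsub>R\<^esub>} \<and>
       x = lincomb M (\<lambda>i. c i x) e) \<and>
    (\<forall>i. \<forall>x\<in>carrier M. \<forall>y\<in>carrier M. c i (x \<oplus>\<^bsub>M\<^esub> y) = c i x \<oplus>\<^bsub>R\<^esub> c i y) \<and>
    (\<forall>i. \<forall>r\<in>carrier R. \<forall>x\<in>carrier M. c i (r \<odot>\<^bsub>M\<^esub> x) = r \<otimes>\<^bsub>R\<^esub> c i x)"

text \<open>The coefficients in a basis are unique, so the coefficients of a sum or of a multiple must be
  the sums or multiples of the coefficients. Elements outside the basis serve as indices of the zero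
  vector.\<close>

lemma free_module_dual_basis:
  fixes M :: "('a, 'b, 'm) module_scheme"
  assumes "free_module R M"
  obtains e :: "'b \<Rightarrow> 'b" and c where "dual_basis R M e c"
proof -
  interpret module R M using assms by (simp add: free_module_def)
  obtain B where B: "B \<subseteq> carrier M" and ex1: "\<forall>x\<in>carrier M.
      \<exists>!a. (\<forall>b\<in>B. a b \<in> carrier R) \<and> (\<forall>b. b \<notin> B \<longrightarrow> a b = \<zero>\<^bsub>R\<^esub>)
          \<and> finite {b. a b \<noteq> \<zero>\<^bsub>R\<^esub>}
          \<and> x = (\<Oplus>\<^bsub>M\<^esub> b\<in>{b. a b \<noteq> \<zero>\<^bsub>R\<^esub>}. a b \<odot>\<^bsub>M\<^esub> b)"
    using conjunct2[OF assms[unfolded free_module_def]] by (elim exE conjE)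
  define e where "e b = (if b \<in> B then b else \<zero>\<^bsub>M\<^esub>)" for b
  have e: "e b \<in> carrier M" for b using B by (auto simp: e_def)
  define Q where "Q x a \<longleftrightarrow> (\<forall>b. a b \<in> carrier R) \<and> (\<forall>b. b \<notin> B \<longrightarrow> a b = \<zero>\<^bsub>R\<^esub>)
          \<and> finite {b. a b \<noteq> \<zero>\<^bsub>R\<^esub>} \<and> x = lincomb M a e" for x a
  have Q_iff: "Q x a \<longleftrightarrow> (\<forall>b\<in>B. a b \<in> carrier R) \<and> (\<forall>b. b \<notin> B \<longrightarrow> a b = \<zero>\<^bsub>R\<^esub>)
          \<and> finite {b. a b \<noteq> \<zero>\<^bsub>R\<^esub>}
          \<and> x = (\<Oplus>\<^bsub>M\<^esub> b\<in>{b. a b \<noteq> \<zero>\<^bsub>R\<^esub>}. a b \<odot>\<^bsub>M\<^esub> b)" (is "_ \<longleftrightarrow> ?P x a") for x a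
  proof -
    have "lincomb M a e = (\<Oplus>\<^bsub>M\<^esub> b\<in>{b. a b \<noteq> \<zero>\<^bsub>R\<^esub>}. a b \<odot>\<^bsub>M\<^esub> b)"
      if a: "\<And>b. a b \<in> carrier R" "\<And>b. b \<notin> B \<Longrightarrow> a b = \<zero>\<^bsub>R\<^esub>" "finite {b. a b \<noteq> \<zero>\<^bsub>R\<^esub>}"
    proof -
      have "lincomb M a e = (\<Oplus>\<^bsub>M\<^esub> b\<in>{b. a b \<noteq> \<zero>\<^bsub>R\<^esub>}. a b \<odot>\<^bsub>M\<^esub> e b)"
        by (rule lincomb_eq_finsum) (use a e in auto)
      also have "\<dots> = (\<Oplus>\<^bsub>M\<^esub> b\<in>{b. a b \<noteq> \<zero>\<^bsub>R\<^esub>}. a b \<odot>\<^bsub>M\<^esub> b)"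
        by (rule M.finsum_cong') (use a B in \<open>auto simp: e_def\<close>)
      finally show ?thesis .
    qed
    moreover have "(\<forall>b. a b \<in> carrier R) \<longleftrightarrow> (\<forall>b\<in>B. a b \<in> carrier R)"
      if "\<forall>b. b \<notin> B \<longrightarrow> a b = \<zero>\<^bsub>R\<^esub>"
      using that by (metis R.zero_closed)
    ultimately show ?thesis unfolding Q_def by auto
  qed
  have ex1Q: "\<exists>!a. Q x a" if "x \<in> carrier M" for x
    using bspec[OF ex1 that] by (simp only: Q_iff)
  define c where "c b x = (THE a. Q x a) b" for b x
  have c: "Q x (\<lambda>b. c b x)" if "x \<in> carrier M" for x
    unfolding c_def using theI'[OF ex1Q[OF that]] by simp
  have c_eqI: "c b x = a b" if "x \<in> carrier M" "Q x a" for x a b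
  proof -
    have "(THE a. Q x a) = a"
      by (rule the1_equality) (use ex1Q that in auto)
    then show ?thesis by (simp add: c_def)
  qed
  have "dual_basis R M e c"
    unfolding dual_basis_def
  proof (intro conjI allI ballI)
    fix i x y assume x: "x \<in> carrier M" and y: "y \<in> carrier M"
    have "finite {b. c b x \<oplus>\<^bsub>R\<^esub> c b y \<noteq> \<zero>\<^bsub>R\<^esub>}"
      by (rule finite_subset[of _ "{b. c b x \<noteq> \<zero>\<^bsub>R\<^esub>} \<union> {b. c b y \<noteq> \<zero>\<^bsub>R\<^esub>}"])
         (use c[OF x] c[OF y] in \<open>auto simp: Q_def\<close>)
    then have "Q (x \<oplus>\<^bsub>M\<^esub> y) (\<lambda>b. c b x \<oplus>\<^bsub>R\<^esub> c b y)"
      using c[OF x] c[OF y] e unfolding Q_def by (simp add: lincomb_add)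
    then show "c i (x \<oplus>\<^bsub>M\<^esub> y) = c i x \<oplus>\<^bsub>R\<^esub> c i y"
      using c_eqI x y by blast
  next
    fix i r x assume r: "r \<in> carrier R" and x: "x \<in> carrier M"
    have "finite {b. r \<otimes>\<^bsub>R\<^esub> c b x \<noteq> \<zero>\<^bsub>R\<^esub>}"
      by (rule finite_subset[of _ "{b. c b x \<noteq> \<zero>\<^bsub>R\<^esub>}"])
         (use c[OF x] r in \<open>auto simp: Q_def\<close>)
    then have "Q (r \<odot>\<^bsub>M\<^esub> x) (\<lambda>b. r \<otimes>\<^bsub>R\<^esub> c b x)"
      using c[OF x] e r unfolding Q_def by (simp add: lincomb_smult)
    then show "c i (r \<odot>\<^bsub>M\<^esub> x) = r \<otimes>\<^bsub>R\<^esub> c i x"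
      using c_eqI x r by blast
  qed (use c e in \<open>auto simp: Q_def\<close>)
  then show thesis by (rule that)
qed

text \<open>Projectivity: choose preimages of the values of \<open>f\<close> on the generators and extend linearly
  through the coordinates.\<close>

lemma dual_basis_lift:
  assumes "dual_basis R F e c" "module R F" "module R M" "module R N"
    and f: "f \<in> module_hom R F N" and g: "g \<in> module_hom R M N"
    and im: "\<And>x. x \<in> carrier F \<Longrightarrow> f x \<in> g ` carrier M"
  obtains h where "h \<in> module_hom R F M" "\<And>x. x \<in> carrier F \<Longrightarrow> g (h x) = f x"
proof -
  interpret F: module R F by fact
  interpret M: module R M by fact
  have e: "e i \<in> carrier F" for i using assms(1) by (simp add: dual_basis_def)
  have c: "c i x \<in> carrier R" "finite {i. c i x \<noteq> \<zero>\<^bsub>R\<^esub>}" "lincomb F (\<lambda>i. c i x) e = x"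
    if "x \<in> carrier F" for i x using assms(1) that by (auto simp: dual_basis_def)
  have "\<exists>y. y \<in> carrier M \<and> g y = f (e i)" for i using im[OF e] by (metis imageE)
  then obtain y where y: "\<And>i. y i \<in> carrier M" "\<And>i. g (y i) = f (e i)" by metis
  define h where "h x = lincomb M (\<lambda>i. c i x) y" for x
  show thesis
  proof
    show "h \<in> module_hom R F M"
      by (rule module_homI)
         (use assms(1) c y in \<open>auto simp: h_def M.lincomb_add[symmetric] M.lincomb_smult[symmetric]
            dual_basis_def intro!: M.lincomb_closed\<close>)
    show "g (h x) = f x" if "x \<in> carrier F" for x
    proof -
      have "g (h x) = lincomb N (\<lambda>i. c i x) (\<lambda>i. f (e i))"
        unfolding h_def using module_hom_lincomb[OF assms(3,4) g c(2)[OF that]] c y that by simp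
      also have "\<dots> = f (lincomb F (\<lambda>i. c i x) e)"
        by (rule module_hom_lincomb[OF assms(2,4) f c(2)[OF that], symmetric]) (use c e that in auto)
      finally show ?thesis using c(3) that by simp
    qed
  qed
qed

section \<open>The submodule IM\<close>

inductive_set ideal_smult :: "'a set \<Rightarrow> ('a, 'b, 'm) module_scheme \<Rightarrow> 'b set"
  for I :: "'a set" and M :: "('a, 'b, 'm) module_scheme" where
    smult: "\<lbrakk>a \<in> I; x \<in> carrier M\<rbrakk> \<Longrightarrow> a \<odot>\<^bsub>M\<^esub> x \<in> ideal_smult I M"
  | add: "\<lbrakk>x \<in> ideal_smult I M; y \<in> ideal_smult I M\<rbrakk> \<Longrightarrow> x \<oplus>\<^bsub>M\<^esub> y \<in> ideal_smult I M"

lemma ideal_smult_mono: "x \<in> ideal_smult I M \<Longrightarrow> I \<subseteq> J \<Longrightarrow> x \<in> ideal_smult J M"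
  by (induction rule: ideal_smult.induct) (auto intro: ideal_smult.intros)

context module begin

context fixes I assumes I: "ideal I R" begin

lemma ideal_smult_closed: "x \<in> ideal_smult I M \<Longrightarrow> x \<in> carrier M"
  by (induction rule: ideal_smult.induct) (auto simp: ideal.Icarr[OF I])

lemma zero_ideal_smult: "\<zero>\<^bsub>M\<^esub> \<in> ideal_smult I M"
  using ideal_smult.smult[of \<zero> I "\<zero>\<^bsub>M\<^esub>" M] additive_subgroup.zero_closed[OF ideal.axioms(1)[OF I]]
  by simp

lemma a_inv_ideal_smult: "x \<in> ideal_smult I M \<Longrightarrow> \<ominus>\<^bsub>M\<^esub> x \<in> ideal_smult I M"
proof (induction rule: ideal_smult.induct)
  case (smult a x)
  have "\<ominus> a \<in> I"
    using additive_subgroup.a_inv_closed[OF ideal.axioms(1)[OF I] smult(1)] .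
  then show ?case
    using smult ideal.Icarr[OF I] by (metis ideal_smult.smult smult_l_minus)
next
  case (add x y)
  then show ?case by (simp add: ideal_smult_closed M.minus_add ideal_smult.add)
qed

lemma minus_ideal_smult:
  "\<lbrakk>x \<in> ideal_smult I M; y \<in> ideal_smult I M\<rbrakk> \<Longrightarrow> x \<ominus>\<^bsub>M\<^esub> y \<in> ideal_smult I M"
  by (simp add: a_minus_def a_inv_ideal_smult ideal_smult.add)

lemma finsum_ideal_smult:
  assumes "finite S" "\<And>i. i \<in> S \<Longrightarrow> f i \<in> ideal_smult I M"
  shows "finsum M f S \<in> ideal_smult I M"
  using assms
  by (induction S) (auto simp: zero_ideal_smult M.finsum_insert Pi_iff ideal_smult_closed intro: ideal_smult.add)

lemma lincomb_in_ideal_smult: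
  assumes "finite {i. a i \<noteq> \<zero>}" "\<And>i. a i \<in> I" "\<And>i. y i \<in> carrier M"
  shows "lincomb M a y \<in> ideal_smult I M"
proof -
  have "lincomb M a y = (\<Oplus>\<^bsub>M\<^esub> i\<in>{i. a i \<noteq> \<zero>}. a i \<odot>\<^bsub>M\<^esub> y i)"
    by (rule lincomb_eq_finsum) (use assms ideal.Icarr[OF I] in auto)
  then show ?thesis
    using assms by (simp add: finsum_ideal_smult ideal_smult.smult)
qed

end

end

lemma module_hom_ideal_smult:
  assumes "module R M" "ideal I R" "h \<in> module_hom R M N" "x \<in> ideal_smult I M"
  shows "h x \<in> ideal_smult I N"
  using assms(4)
proof (induction rule: ideal_smult.induct)
  case (smult a x)
  then show ?case
    using assms by (simp add: module_hom_smult module_hom_closed ideal.Icarr ideal_smult.smult)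
next
  case (add x y)
  then show ?case
    using assms by (simp add: module_hom_add module.ideal_smult_closed ideal_smult.add)
qed

text \<open>This recovers membership in \<open>IM\<close> from the coefficients; for the Koszul complex it turns
  a statement about forms with coefficients in \<open>J\<close> into one about submodules.\<close>

lemma dual_basis_ideal_smultI:
  assumes "module R M" "ideal I R" "dual_basis R M e c" "x \<in> carrier M" "\<And>i. c i x \<in> I"
  shows "x \<in> ideal_smult I M"
proof -
  have "lincomb M (\<lambda>i. c i x) e \<in> ideal_smult I M"
    by (rule module.lincomb_in_ideal_smult[OF assms(1,2)]) (use assms in \<open>auto simp: dual_basis_def\<close>)
  then show ?thesis using assms(3,4) by (simp add: dual_basis_def)
qed

section \<open>Comparison of resolutions\<close>

text \<open>Exactness is split into elementwise inclusions, and freeness is left out: it enters the lemmas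
  below as a dual basis, which may be indexed by any type.\<close>

locale resolution = N: module R N
  for R :: "('a, 'r) ring_scheme" and N :: "('a, 'b, 'm) module_scheme"
    and P :: "nat \<Rightarrow> ('a, 'c, 'n) module_scheme" and \<delta> :: "nat \<Rightarrow> 'c \<Rightarrow> 'c" and \<epsilon> :: "'c \<Rightarrow> 'b" +
  assumes module: "module R (P n)"
    and \<delta>_hom: "\<delta> n \<in> module_hom R (P (Suc n)) (P n)"
    and \<epsilon>_hom: "\<epsilon> \<in> module_hom R (P 0) N"
    and \<epsilon>_surj: "y \<in> carrier N \<Longrightarrow> y \<in> \<epsilon> ` carrier (P 0)"
    and \<epsilon>_\<delta>: "x \<in> carrier (P (Suc 0)) \<Longrightarrow> \<epsilon> (\<delta> 0 x) = \<zero>\<^bsub>N\<^esub>"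
    and exact_0: "\<lbrakk>x \<in> carrier (P 0); \<epsilon> x = \<zero>\<^bsub>N\<^esub>\<rbrakk> \<Longrightarrow> x \<in> \<delta> 0 ` carrier (P (Suc 0))"
    and \<delta>_\<delta>: "x \<in> carrier (P (Suc (Suc n))) \<Longrightarrow> \<delta> n (\<delta> (Suc n) x) = \<zero>\<^bsub>P n\<^esub>"
    and exact: "\<lbrakk>x \<in> carrier (P (Suc n)); \<delta> n x = \<zero>\<^bsub>P n\<^esub>\<rbrakk>
       \<Longrightarrow> x \<in> \<delta> (Suc n) ` carrier (P (Suc (Suc n)))"

lemma free_resolution_resolution:
  assumes "module R N" "free_resolution R N P \<delta> \<epsilon>"
  shows "resolution R N P \<delta> \<epsilon>"
proof -
  interpret N: module R N by fact
  have ker0: "a_kernel (P 0) N \<epsilon> = \<delta> 0 ` carrier (P (Suc 0))"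
    and ker: "a_kernel (P (Suc n)) (P n) (\<delta> n) = \<delta> (Suc n) ` carrier (P (Suc (Suc n)))"
    and onto: "\<epsilon> ` carrier (P 0) = carrier N"
    and hom: "\<epsilon> \<in> module_hom R (P 0) N" "\<delta> n \<in> module_hom R (P (Suc n)) (P n)"
    and free: "free_module R (P n)" for n
    using assms(2) unfolding free_resolution_def by simp_all
  show ?thesis
  proof (unfold resolution_def resolution_axioms_def, intro conjI allI impI)
    fix n
    show "module R N" by fact
    show "module R (P n)" using free by (simp add: free_module_def)
    show "\<delta> n \<in> module_hom R (P (Suc n)) (P n)" "\<epsilon> \<in> module_hom R (P 0) N" by (rule hom)+
    show "x \<in> \<epsilon> ` carrier (P 0)" if "x \<in> carrier N" for x using that onto by simp
    show "\<epsilon> (\<delta> 0 x) = \<zero>\<^bsub>N\<^esub>" if "x \<in> carrier (P (Suc 0))" for x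
      using imageI[OF that, of "\<delta> 0"] unfolding ker0[symmetric] a_kernel_def' by simp
    show "x \<in> \<delta> 0 ` carrier (P (Suc 0))" if "x \<in> carrier (P 0)" "\<epsilon> x = \<zero>\<^bsub>N\<^esub>" for x
      using that unfolding ker0[symmetric] a_kernel_def' by simp
    show "\<delta> n (\<delta> (Suc n) x) = \<zero>\<^bsub>P n\<^esub>" if "x \<in> carrier (P (Suc (Suc n)))" for x
      using imageI[OF that, of "\<delta> (Suc n)"] unfolding ker[symmetric] a_kernel_def' by simp
    show "x \<in> \<delta> (Suc n) ` carrier (P (Suc (Suc n)))"
      if "x \<in> carrier (P (Suc n))" "\<delta> n x = \<zero>\<^bsub>P n\<^esub>" for x
      using that unfolding ker[symmetric] a_kernel_def' by simp
  qed
qed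

text \<open>A projective complex maps to an exact one over the identity of \<open>N\<close>, one degree after the
  other. A homomorphism \<open>f\<close> in degree \<open>n\<close> can be continued as soon as it sends
  boundaries to boundaries, so this is the invariant of the recursion.\<close>

lemma comparison_map:
  assumes F: "resolution R N F \<delta> \<epsilon>" and G: "resolution R N G \<delta>' \<epsilon>'"
    and basis: "\<And>n. dual_basis R (F n) (e n) (c n)"
  obtains \<phi> where "\<And>n. \<phi> n \<in> module_hom R (F n) (G n)"
    and "\<And>x. x \<in> carrier (F 0) \<Longrightarrow> \<epsilon>' (\<phi> 0 x) = \<epsilon> x"
    and "\<And>n x. x \<in> carrier (F (Suc n)) \<Longrightarrow> \<delta>' n (\<phi> (Suc n) x) = \<phi> n (\<delta> n x)"
proof -
  interpret F: resolution R N F \<delta> \<epsilon> by fact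
  interpret G: resolution R N G \<delta>' \<epsilon>' by fact
  define lifts where "lifts n f \<longleftrightarrow> f \<in> module_hom R (F n) (G n) \<and>
      (\<forall>x\<in>carrier (F (Suc n)). f (\<delta> n x) \<in> \<delta>' n ` carrier (G (Suc n))) \<and>
      (n = 0 \<longrightarrow> (\<forall>x\<in>carrier (F 0). \<epsilon>' (f x) = \<epsilon> x))" for n f
  have "\<exists>f. lifts 0 f"
  proof -
    obtain f where f: "f \<in> module_hom R (F 0) (G 0)" "\<And>x. x \<in> carrier (F 0) \<Longrightarrow> \<epsilon>' (f x) = \<epsilon> x"
      by (rule dual_basis_lift[OF basis F.module G.module F.N.module_axioms F.\<epsilon>_hom G.\<epsilon>_hom])
         (use G.\<epsilon>_surj module_hom_closed[OF F.\<epsilon>_hom] in auto)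
    have "f (\<delta> 0 x) \<in> \<delta>' 0 ` carrier (G (Suc 0))" if "x \<in> carrier (F (Suc 0))" for x
      by (rule G.exact_0) (use that f F.\<epsilon>_\<delta> module_hom_closed[OF F.\<delta>_hom] module_hom_closed[OF f(1)] in auto)
    then show ?thesis using f unfolding lifts_def by blast
  qed
  moreover have "\<exists>g. lifts (Suc n) g \<and> (\<forall>x\<in>carrier (F (Suc n)). \<delta>' n (g x) = f (\<delta> n x))"
    if "lifts n f" for n f
  proof -
    from that have f: "f \<in> module_hom R (F n) (G n)"
      "\<And>x. x \<in> carrier (F (Suc n)) \<Longrightarrow> f (\<delta> n x) \<in> \<delta>' n ` carrier (G (Suc n))"
      by (auto simp: lifts_def)
    obtain g where g: "g \<in> module_hom R (F (Suc n)) (G (Suc n))"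
        "\<And>x. x \<in> carrier (F (Suc n)) \<Longrightarrow> \<delta>' n (g x) = f (\<delta> n x)"
      by (rule dual_basis_lift[OF basis F.module G.module G.module
            module_hom_comp[OF f(1) F.\<delta>_hom] G.\<delta>_hom]) (use f in auto)
    have "g (\<delta> (Suc n) x) \<in> \<delta>' (Suc n) ` carrier (G (Suc (Suc n)))"
      if "x \<in> carrier (F (Suc (Suc n)))" for x
    proof (rule G.exact)
      have "\<delta>' n (g (\<delta> (Suc n) x)) = f (\<delta> n (\<delta> (Suc n) x))"
        using g that module_hom_closed[OF F.\<delta>_hom] by simp
      then show "\<delta>' n (g (\<delta> (Suc n) x)) = \<zero>\<^bsub>G n\<^esub>"
        using F.\<delta>_\<delta>[OF that] module_hom_zero[OF F.module G.module f(1)] by simp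
    qed (use that g module_hom_closed[OF F.\<delta>_hom] module_hom_closed[OF g(1)] in auto)
    then show ?thesis using g unfolding lifts_def by blast
  qed
  ultimately obtain \<phi> where "\<And>n. lifts n (\<phi> n)"
      "\<And>n x. x \<in> carrier (F (Suc n)) \<Longrightarrow> \<delta>' n (\<phi> (Suc n) x) = \<phi> n (\<delta> n x)"
    using dependent_nat_choice[of lifts "\<lambda>n f g. \<forall>x\<in>carrier (F (Suc n)). \<delta>' n (g x) = f (\<delta> n x)"]
    by metis
  then show thesis using that[of \<phi>] by (simp add: lifts_def)
qed

text \<open>If \<open>\<chi>\<close> lifts the identity of \<open>N\<close>, then \<open>id - \<chi>\<close> lifts zero and is therefore
  null homotopic. The homotopy is built degree by degree; \<open>s\<close> in degree \<open>n\<close> can be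
  continued as soon as \<open>(id - \<chi>) - s \<delta>\<close> takes cycles as values in the next degree.\<close>

lemma homotopic_to_identity:
  assumes P: "resolution R N P \<delta> \<epsilon>"
    and basis: "\<And>n. dual_basis R (P n) (e n) (c n)"
    and \<chi>: "\<And>n. \<chi> n \<in> module_hom R (P n) (P n)"
    and \<chi>_\<epsilon>: "\<And>x. x \<in> carrier (P 0) \<Longrightarrow> \<epsilon> (\<chi> 0 x) = \<epsilon> x"
    and \<chi>_\<delta>: "\<And>n x. x \<in> carrier (P (Suc n)) \<Longrightarrow> \<delta> n (\<chi> (Suc n) x) = \<chi> n (\<delta> n x)"
  obtains s where "\<And>n. s n \<in> module_hom R (P n) (P (Suc n))"
    and "\<And>n x. x \<in> carrier (P (Suc n)) \<Longrightarrow>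
      \<delta> (Suc n) (s (Suc n) x) = x \<ominus>\<^bsub>P (Suc n)\<^esub> \<chi> (Suc n) x \<ominus>\<^bsub>P (Suc n)\<^esub> s n (\<delta> n x)"
proof -
  interpret P: resolution R N P \<delta> \<epsilon> by fact
  interpret Pn: module R "P n" for n by (rule P.module)
  define f where "f n x = x \<ominus>\<^bsub>P n\<^esub> \<chi> n x" for n x
  have f: "f n \<in> module_hom R (P n) (P n)" for n
    unfolding f_def by (rule module_hom_diff[OF P.module module_hom_id \<chi>])
  have f_\<delta>: "\<delta> n (f (Suc n) x) = f n (\<delta> n x)" if "x \<in> carrier (P (Suc n))" for n x
    using that module_hom_closed[OF \<chi>]
    by (simp add: f_def module_hom_minus[OF P.module P.module P.\<delta>_hom] \<chi>_\<delta>)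
  define lifts where "lifts n s \<longleftrightarrow> s \<in> module_hom R (P n) (P (Suc n)) \<and>
      (\<forall>x\<in>carrier (P (Suc n)). \<delta> n (s (\<delta> n x)) = \<delta> n (f (Suc n) x))" for n s
  have "\<exists>s. lifts 0 s"
  proof -
    have "\<epsilon> (f 0 x) = \<zero>\<^bsub>N\<^esub>" if "x \<in> carrier (P 0)" for x
      using that module_hom_closed[OF \<chi>] module_hom_closed[OF P.\<epsilon>_hom]
      by (simp add: f_def module_hom_minus[OF P.module P.N.module_axioms P.\<epsilon>_hom] \<chi>_\<epsilon>)
    then obtain s where "s \<in> module_hom R (P 0) (P (Suc 0))"
        "\<And>x. x \<in> carrier (P 0) \<Longrightarrow> \<delta> 0 (s x) = f 0 x"
      using dual_basis_lift[OF basis P.module P.module P.module f P.\<delta>_hom]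
        P.exact_0 module_hom_closed[OF f] by blast
    then have "lifts 0 s"
      using module_hom_closed[OF P.\<delta>_hom] by (simp add: lifts_def f_\<delta>)
    then show ?thesis by blast
  qed
  moreover have "\<exists>t. lifts (Suc n) t \<and>
      (\<forall>x\<in>carrier (P (Suc n)). \<delta> (Suc n) (t x) = f (Suc n) x \<ominus>\<^bsub>P (Suc n)\<^esub> s (\<delta> n x))"
    if "lifts n s" for n s
  proof -
    from that have s: "s \<in> module_hom R (P n) (P (Suc n))"
      "\<And>x. x \<in> carrier (P (Suc n)) \<Longrightarrow> \<delta> n (s (\<delta> n x)) = \<delta> n (f (Suc n) x)"
      by (auto simp: lifts_def)
    have s_\<delta>: "(\<lambda>x. s (\<delta> n x)) \<in> module_hom R (P (Suc n)) (P (Suc n))"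
      by (rule module_hom_comp[OF s(1) P.\<delta>_hom])
    have "f (Suc n) x \<ominus>\<^bsub>P (Suc n)\<^esub> s (\<delta> n x) \<in> \<delta> (Suc n) ` carrier (P (Suc (Suc n)))"
      if "x \<in> carrier (P (Suc n))" for x
    proof (rule P.exact)
      show "\<delta> n (f (Suc n) x \<ominus>\<^bsub>P (Suc n)\<^esub> s (\<delta> n x)) = \<zero>\<^bsub>P n\<^esub>"
        using that s module_hom_closed[OF f] module_hom_closed[OF s_\<delta>] module_hom_closed[OF P.\<delta>_hom]
        by (simp add: module_hom_minus[OF P.module P.module P.\<delta>_hom])
    qed (use that module_hom_closed[OF f] module_hom_closed[OF s_\<delta>] in auto)
    then obtain t where t: "t \<in> module_hom R (P (Suc n)) (P (Suc (Suc n)))"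
        "\<And>x. x \<in> carrier (P (Suc n)) \<Longrightarrow> \<delta> (Suc n) (t x) = f (Suc n) x \<ominus>\<^bsub>P (Suc n)\<^esub> s (\<delta> n x)"
      using dual_basis_lift[OF basis P.module P.module P.module
          module_hom_diff[OF P.module f s_\<delta>] P.\<delta>_hom] by blast
    have "\<delta> (Suc n) (t (\<delta> (Suc n) x)) = \<delta> (Suc n) (f (Suc (Suc n)) x)"
      if "x \<in> carrier (P (Suc (Suc n)))" for x
      using that t(2) f_\<delta> P.\<delta>_\<delta> module_hom_closed[OF P.\<delta>_hom] module_hom_closed[OF f]
      by (simp add: module_hom_zero[OF P.module P.module s(1)] Pn.M.minus_zero_right)
    then show ?thesis using t unfolding lifts_def by blast
  qed
  ultimately obtain s where "\<And>n. lifts n (s n)"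
      "\<And>n x. x \<in> carrier (P (Suc n)) \<Longrightarrow>
         \<delta> (Suc n) (s (Suc n) x) = f (Suc n) x \<ominus>\<^bsub>P (Suc n)\<^esub> s n (\<delta> n x)"
    using dependent_nat_choice[of lifts "\<lambda>n s t. \<forall>x\<in>carrier (P (Suc n)).
        \<delta> (Suc n) (t x) = f (Suc n) x \<ominus>\<^bsub>P (Suc n)\<^esub> s (\<delta> n x)"]
    by metis
  then show thesis using that[of s] by (simp add: lifts_def f_def)
qed

text \<open>The property that a chain whose boundary vanishes modulo \<open>I\<close> is a boundary modulo
  \<open>J\<close> does not depend on the resolution. With comparison maps \<open>\<phi>\<close> to \<open>K\<close> and
  \<open>\<psi>\<close> back, \<open>\<phi> p\<close> is \<open>\<delta>' v\<close> modulo \<open>J\<close>; applying \<open>\<psi>\<close> shows that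
  \<open>\<psi> (\<phi> p)\<close> is \<open>\<delta> (\<psi> v)\<close> modulo \<open>J\<close>. The homotopy replaces
  \<open>\<psi> (\<phi> p)\<close> by \<open>p\<close>, up to the boundary \<open>\<delta> (s p)\<close> and the error \<open>s (\<delta> p)\<close>, which
  lies in \<open>I P\<close>. All of this works because module homomorphisms preserve \<open>I M\<close> and
  \<open>J M\<close>.\<close>

lemma relative_boundary_transfer:
  assumes P: "resolution R N P \<delta> \<epsilon>" and K: "resolution R N K \<delta>' \<epsilon>'"
    and basis: "\<And>n. dual_basis R (P n) (e n) (c n)" "\<And>n. dual_basis R (K n) (e' n) (c' n)"
    and IJ: "ideal I R" "ideal J R" "I \<subseteq> J"
    and K_IJ: "\<And>w. \<lbrakk>w \<in> carrier (K (Suc n)); \<delta>' n w \<in> ideal_smult I (K n)\<rbrakk>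
      \<Longrightarrow> \<exists>v\<in>carrier (K (Suc (Suc n))). w \<ominus>\<^bsub>K (Suc n)\<^esub> \<delta>' (Suc n) v \<in> ideal_smult J (K (Suc n))"
    and p: "p \<in> carrier (P (Suc n))" "\<delta> n p \<in> ideal_smult I (P n)"
  shows "\<exists>q\<in>carrier (P (Suc (Suc n))). p \<ominus>\<^bsub>P (Suc n)\<^esub> \<delta> (Suc n) q \<in> ideal_smult J (P (Suc n))"
proof -
  interpret P: resolution R N P \<delta> \<epsilon> by fact
  interpret K: resolution R N K \<delta>' \<epsilon>' by fact
  interpret Pn: module R "P (Suc n)" by (rule P.module)
  obtain \<phi> where \<phi>: "\<And>n. \<phi> n \<in> module_hom R (P n) (K n)"
    "\<And>x. x \<in> carrier (P 0) \<Longrightarrow> \<epsilon>' (\<phi> 0 x) = \<epsilon> x"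
    "\<And>n x. x \<in> carrier (P (Suc n)) \<Longrightarrow> \<delta>' n (\<phi> (Suc n) x) = \<phi> n (\<delta> n x)"
    by (rule comparison_map[OF P K basis(1)]) blast
  obtain \<psi> where \<psi>: "\<And>n. \<psi> n \<in> module_hom R (K n) (P n)"
    "\<And>x. x \<in> carrier (K 0) \<Longrightarrow> \<epsilon> (\<psi> 0 x) = \<epsilon>' x"
    "\<And>n x. x \<in> carrier (K (Suc n)) \<Longrightarrow> \<delta> n (\<psi> (Suc n) x) = \<psi> n (\<delta>' n x)"
    by (rule comparison_map[OF K P basis(2)]) blast
  obtain s where s: "\<And>n. s n \<in> module_hom R (P n) (P (Suc n))"
    "\<And>n x. x \<in> carrier (P (Suc n)) \<Longrightarrow>
      \<delta> (Suc n) (s (Suc n) x) = x \<ominus>\<^bsub>P (Suc n)\<^esub> \<psi> (Suc n) (\<phi> (Suc n) x) \<ominus>\<^bsub>P (Suc n)\<^esub> s n (\<delta> n x)"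
    by (rule homotopic_to_identity[OF P basis(1), where \<chi>="\<lambda>n x. \<psi> n (\<phi> n x)"])
       (use \<phi>(2,3) \<psi>(2,3) in \<open>auto simp: module_hom_closed[OF \<phi>(1)] intro: module_hom_comp[OF \<psi>(1) \<phi>(1)]\<close>)
  have "\<delta>' n (\<phi> (Suc n) p) \<in> ideal_smult I (K n)"
    using \<phi>(3) p module_hom_ideal_smult[OF P.module IJ(1) \<phi>(1)] by simp
  then obtain v where v: "v \<in> carrier (K (Suc (Suc n)))"
    "\<phi> (Suc n) p \<ominus>\<^bsub>K (Suc n)\<^esub> \<delta>' (Suc n) v \<in> ideal_smult J (K (Suc n))"
    using K_IJ module_hom_closed[OF \<phi>(1) p(1)] by blast
  define q where "q = \<psi> (Suc (Suc n)) v \<oplus>\<^bsub>P (Suc (Suc n))\<^esub> s (Suc n) p"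
  let ?u = "\<psi> (Suc n) (\<phi> (Suc n) p)" and ?t = "\<psi> (Suc n) (\<delta>' (Suc n) v)" and ?r = "s n (\<delta> n p)"
  have cl: "?u \<in> carrier (P (Suc n))" "?t \<in> carrier (P (Suc n))" "?r \<in> carrier (P (Suc n))"
    using p v by (auto intro!: module_hom_closed[OF \<psi>(1)] module_hom_closed[OF \<phi>(1)]
        module_hom_closed[OF K.\<delta>_hom] module_hom_closed[OF s(1)] module_hom_closed[OF P.\<delta>_hom])
  have q: "q \<in> carrier (P (Suc (Suc n)))" unfolding q_def
    using module_hom_closed[OF \<psi>(1) v(1)] module_hom_closed[OF s(1) p(1)]
    by (meson P.module module_def abelian_group_def abelian_monoid.a_closed)
  have "\<psi> (Suc n) (\<phi> (Suc n) p \<ominus>\<^bsub>K (Suc n)\<^esub> \<delta>' (Suc n) v) = ?u \<ominus>\<^bsub>P (Suc n)\<^esub> ?t"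
    by (rule module_hom_minus[OF K.module P.module \<psi>(1)])
       (use p v in \<open>auto intro!: module_hom_closed[OF \<phi>(1)] module_hom_closed[OF K.\<delta>_hom]\<close>)
  then have 1: "?u \<ominus>\<^bsub>P (Suc n)\<^esub> ?t \<in> ideal_smult J (P (Suc n))"
    using module_hom_ideal_smult[OF K.module IJ(2) \<psi>(1) v(2)] by simp
  have 2: "?r \<in> ideal_smult J (P (Suc n))"
    by (rule ideal_smult_mono[OF module_hom_ideal_smult[OF P.module IJ(1) s(1) p(2)] IJ(3)])
  have "\<delta> (Suc n) q = ?t \<oplus>\<^bsub>P (Suc n)\<^esub> (p \<ominus>\<^bsub>P (Suc n)\<^esub> ?u \<ominus>\<^bsub>P (Suc n)\<^esub> ?r)"
    unfolding q_def using p v s(2) \<psi>(3)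
    by (simp add: module_hom_add[OF P.\<delta>_hom] module_hom_closed[OF \<psi>(1)] module_hom_closed[OF s(1)])
  then have "p \<ominus>\<^bsub>P (Suc n)\<^esub> \<delta> (Suc n) q = (?u \<ominus>\<^bsub>P (Suc n)\<^esub> ?t) \<oplus>\<^bsub>P (Suc n)\<^esub> ?r"
    using cl p(1) by (simp add: Pn.minus_telescope)
  then show ?thesis
    using q 1 2 ideal_smult.add by metis
qed

section \<open>Residue class modules\<close>

context ideal begin

lemma carrier_quot_module: "x \<in> carrier (quot_module R I) \<longleftrightarrow> (\<exists>a\<in>carrier R. x = I +> a)"
  by (auto simp: quot_module_def A_RCOSETS_def')

lemma quot_module_add:
  "\<lbrakk>a \<in> carrier R; b \<in> carrier R\<rbrakk> \<Longrightarrow> (I +> a) \<oplus>\<^bsub>quot_module R I\<^esub> (I +> b) = I +> (a \<oplus> b)"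
  by (simp add: quot_module_def a_rcos_sum)

lemma quot_module_smult:
  "\<lbrakk>r \<in> carrier R; a \<in> carrier R\<rbrakk> \<Longrightarrow> r \<odot>\<^bsub>quot_module R I\<^esub> (I +> a) = I +> (r \<otimes> a)"
  by (simp add: quot_module_def rcoset_mult_add)

lemma quot_module_zero: "\<zero>\<^bsub>quot_module R I\<^esub> = I +> \<zero>"
  using a_rcos_zero[OF ideal_axioms additive_subgroup.zero_closed[OF is_additive_subgroup]]
  by (simp add: quot_module_def)

end

lemma quot_module_module:
  assumes "cring R" "ideal I R"
  shows "module R (quot_module R I)"
proof -
  interpret cring R by fact
  interpret ideal I R by fact
  note [simp] = quot_module_add quot_module_smult quot_module_zero
  show ?thesis
  proof (rule moduleI)
    show "abelian_group (quot_module R I)"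
    proof (rule abelian_groupI)
      fix x assume "x \<in> carrier (quot_module R I)"
      then obtain a where a: "a \<in> carrier R" "x = I +>\<^bsub>R\<^esub> a" by (auto simp: carrier_quot_module)
      then show "\<exists>y\<in>carrier (quot_module R I). y \<oplus>\<^bsub>quot_module R I\<^esub> x = \<zero>\<^bsub>quot_module R I\<^esub>"
        by (intro bexI[of _ "I +>\<^bsub>R\<^esub> (\<ominus>\<^bsub>R\<^esub> a)"]) (auto simp: carrier_quot_module l_neg)
      show "\<zero>\<^bsub>quot_module R I\<^esub> \<oplus>\<^bsub>quot_module R I\<^esub> x = x" using a by simp
    qed (auto simp: carrier_quot_module a_ac)
  qed (use assms in \<open>auto simp: carrier_quot_module l_distr r_distr m_assoc\<close>)
qed

lemma quot_proj_coset:
  assumes "cring R" "ideal I R" "ideal J R" "I \<subseteq> J" "a \<in> carrier R"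
  shows "quot_proj R J (I +>\<^bsub>R\<^esub> a) = J +>\<^bsub>R\<^esub> a"
proof -
  interpret cring R by fact
  interpret I: ideal I R by fact
  interpret J: ideal J R by fact
  have "J +>\<^bsub>R\<^esub> x = J +>\<^bsub>R\<^esub> a" if "x \<in> I +>\<^bsub>R\<^esub> a" for x
  proof -
    from that obtain i where i: "i \<in> I" "x = i \<oplus>\<^bsub>R\<^esub> a" by (auto simp: a_r_coset_def')
    then have "i \<in> carrier R" by simp
    then have "x \<ominus>\<^bsub>R\<^esub> a = i"
      using i assms(5) by (simp add: a_minus_def a_assoc r_neg)
    then show ?thesis
      using i assms \<open>i \<in> carrier R\<close> by (subst quotient_eq_iff_same_a_r_cos[symmetric]) auto
  qed
  moreover have "a \<in> I +>\<^bsub>R\<^esub> a" by (rule I.a_rcos_self) fact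
  ultimately show ?thesis unfolding quot_proj_def by blast
qed

lemma quot_proj_module_hom:
  assumes "cring R" "ideal I R" "ideal J R" "I \<subseteq> J"
  shows "quot_proj R J \<in> module_hom R (quot_module R I) (quot_module R J)"
proof -
  interpret cring R by fact
  interpret I: ideal I R by fact
  interpret J: ideal J R by fact
  note p = quot_proj_coset[OF assms]
  show ?thesis
    by (rule module_homI)
       (auto simp: I.carrier_quot_module J.carrier_quot_module p I.quot_module_add J.quot_module_add
          I.quot_module_smult J.quot_module_smult)
qed

section \<open>Tensor products and Tor with a residue class module\<close>

text \<open>Induction over the relations of a tensor product, with inverses and products of the free
  abelian group written additively. The conclusion repeats membership in the carrier because group
  inverses are negatives only there.\<close>

lemma tensor_relations_induct [consumes 3, case_names zero add uminus left right balance]: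
  fixes M :: "('a, 'b, 'm) module_scheme" and N :: "('a, 'c, 'n) module_scheme"
  assumes "module R M" "module R N" and c: "c \<in> tensor_relations R M N"
    and zero: "Q 0"
    and add: "\<And>a b. \<lbrakk>a \<in> carrier (tensor_free M N); b \<in> carrier (tensor_free M N); Q a; Q b\<rbrakk> \<Longrightarrow> Q (a + b)"
    and uminus: "\<And>a. \<lbrakk>a \<in> carrier (tensor_free M N); Q a\<rbrakk> \<Longrightarrow> Q (- a)"
    and left: "\<And>x x' y. \<lbrakk>x \<in> carrier M; x' \<in> carrier M; y \<in> carrier N\<rbrakk>
       \<Longrightarrow> Q (frag_of (x \<oplus>\<^bsub>M\<^esub> x', y) - frag_of (x, y) - frag_of (x', y))"
    and right: "\<And>x y y'. \<lbrakk>x \<in> carrier M; y \<in> carrier N; y' \<in> carrier N\<rbrakk>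
       \<Longrightarrow> Q (frag_of (x, y \<oplus>\<^bsub>N\<^esub> y') - frag_of (x, y) - frag_of (x, y'))"
    and balance: "\<And>r x y. \<lbrakk>r \<in> carrier R; x \<in> carrier M; y \<in> carrier N\<rbrakk>
       \<Longrightarrow> Q (frag_of (r \<odot>\<^bsub>M\<^esub> x, y) - frag_of (x, r \<odot>\<^bsub>N\<^esub> y))"
  shows "c \<in> carrier (tensor_free M N) \<and> Q c"
proof -
  interpret M: module R M by fact
  interpret N: module R N by fact
  let ?T = "tensor_free M N"
  let ?S = "{frag_of (x \<oplus>\<^bsub>M\<^esub> x', y) - frag_of (x, y) - frag_of (x', y) | x x' y.
        x \<in> carrier M \<and> x' \<in> carrier M \<and> y \<in> carrier N} \<union>
     {frag_of (x, y \<oplus>\<^bsub>N\<^esub> y') - frag_of (x, y) - frag_of (x, y') | x y y'.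
        x \<in> carrier M \<and> y \<in> carrier N \<and> y' \<in> carrier N} \<union>
     {frag_of (r \<odot>\<^bsub>M\<^esub> x, y) - frag_of (x, r \<odot>\<^bsub>N\<^esub> y) | r x y.
        r \<in> carrier R \<and> x \<in> carrier M \<and> y \<in> carrier N}"
  have frag: "frag_of (x, y) \<in> carrier ?T" if "x \<in> carrier M" "y \<in> carrier N" for x y
    using that by (simp add: tensor_free_def)
  have diff: "a - b \<in> carrier ?T" if "a \<in> carrier ?T" "b \<in> carrier ?T" for a b
    using that keys_diff[of a b] by (auto simp: tensor_free_def)
  have neg: "- a \<in> carrier ?T" if "a \<in> carrier ?T" for a
    using that by (simp add: tensor_free_def)
  have plus: "a + b \<in> carrier ?T" if "a \<in> carrier ?T" "b \<in> carrier ?T" for a b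
    using diff[OF that(1) neg[OF that(2)]] by simp
  have gen: "a \<in> carrier ?T \<and> Q a" if "a \<in> ?S" for a
    using that
  proof (elim UnE CollectE exE conjE)
    fix x x' y assume "a = frag_of (x \<oplus>\<^bsub>M\<^esub> x', y) - frag_of (x, y) - frag_of (x', y)"
      "x \<in> carrier M" "x' \<in> carrier M" "y \<in> carrier N"
    then show ?thesis using left by (auto intro!: diff frag)
  next
    fix x y y' assume "a = frag_of (x, y \<oplus>\<^bsub>N\<^esub> y') - frag_of (x, y) - frag_of (x, y')"
      "x \<in> carrier M" "y \<in> carrier N" "y' \<in> carrier N"
    then show ?thesis using right by (auto intro!: diff frag)
  next
    fix r x y assume "a = frag_of (r \<odot>\<^bsub>M\<^esub> x, y) - frag_of (x, r \<odot>\<^bsub>N\<^esub> y)"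
      "r \<in> carrier R" "x \<in> carrier M" "y \<in> carrier N"
    then show ?thesis using balance by (auto intro!: diff frag)
  qed
  have ops: "\<one>\<^bsub>?T\<^esub> = 0" "inv\<^bsub>?T\<^esub> a = - a" "a \<otimes>\<^bsub>?T\<^esub> b = a + b" if "a \<in> carrier ?T" for a b
    using that by (simp_all add: tensor_free_def)
  have zT: "0 \<in> carrier ?T" "\<one>\<^bsub>?T\<^esub> = 0" by (simp_all add: tensor_free_def)
  show ?thesis
    using c unfolding tensor_relations_def
  proof (induction rule: generate.induct)
    case one
    then show ?case using zT zero by simp
  next
    case (incl h)
    then show ?case by (rule gen)
  next
    case (inv h)
    then show ?case using gen[OF inv] by (simp add: ops neg uminus)
  next
    case (eng a b)
    then show ?case by (simp add: ops plus add)
  qed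
qed

locale tensor = M: module R M + N: module R N
  for R :: "('a, 'r) ring_scheme" and M :: "('a, 'b, 'm) module_scheme"
    and N :: "('a, 'c, 'n) module_scheme"
begin

abbreviation T where "T \<equiv> tensor_free M N"
abbreviation Rel where "Rel \<equiv> tensor_relations R M N"

lemma T_simps:
  "\<one>\<^bsub>T\<^esub> = 0" "a \<otimes>\<^bsub>T\<^esub> b = a + b"
  "a \<in> carrier T \<longleftrightarrow> Poly_Mapping.keys a \<subseteq> carrier M \<times> carrier N"
  by (simp_all add: tensor_free_def)

lemma frag_of_T: "\<lbrakk>x \<in> carrier M; y \<in> carrier N\<rbrakk> \<Longrightarrow> frag_of (x, y) \<in> carrier T"
  by (simp add: T_simps)

lemma T_diff: "\<lbrakk>a \<in> carrier T; b \<in> carrier T\<rbrakk> \<Longrightarrow> a - b \<in> carrier T"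
  using keys_diff[of a b] by (auto simp: T_simps)

lemma Rel_subset: "c \<in> Rel \<Longrightarrow> c \<in> carrier T"
  using tensor_relations_induct[OF M.module_axioms N.module_axioms, of c "\<lambda>_. True"] by simp

lemma Rel_zero: "0 \<in> Rel"
  unfolding tensor_relations_def by (subst T_simps(1)[symmetric]) (rule generate.one)

lemma Rel_add: "\<lbrakk>a \<in> Rel; b \<in> Rel\<rbrakk> \<Longrightarrow> a + b \<in> Rel"
  unfolding tensor_relations_def by (subst T_simps(2)[symmetric]) (rule generate.eng)

lemma Rel_generators:
  "\<lbrakk>x \<in> carrier M; x' \<in> carrier M; y \<in> carrier N\<rbrakk>
     \<Longrightarrow> frag_of (x \<oplus>\<^bsub>M\<^esub> x', y) - frag_of (x, y) - frag_of (x', y) \<in> Rel"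
  "\<lbrakk>x \<in> carrier M; y \<in> carrier N; y' \<in> carrier N\<rbrakk>
     \<Longrightarrow> frag_of (x, y \<oplus>\<^bsub>N\<^esub> y') - frag_of (x, y) - frag_of (x, y') \<in> Rel"
  "\<lbrakk>r \<in> carrier R; x \<in> carrier M; y \<in> carrier N\<rbrakk>
     \<Longrightarrow> frag_of (r \<odot>\<^bsub>M\<^esub> x, y) - frag_of (x, r \<odot>\<^bsub>N\<^esub> y) \<in> Rel"
  unfolding tensor_relations_def by (rule generate.incl; blast)+

lemma Rel_uminus:
  assumes "a \<in> Rel" shows "- a \<in> Rel"
proof -
  have "subgroup Rel T"
    unfolding tensor_relations_def
  proof (rule group.generate_is_subgroup)
    show "group T" by (simp add: tensor_free_def)
    show "{frag_of (x \<oplus>\<^bsub>M\<^esub> x', y) - frag_of (x, y) - frag_of (x', y) | x x' y.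
        x \<in> carrier M \<and> x' \<in> carrier M \<and> y \<in> carrier N} \<union>
     {frag_of (x, y \<oplus>\<^bsub>N\<^esub> y') - frag_of (x, y) - frag_of (x, y') | x y y'.
        x \<in> carrier M \<and> y \<in> carrier N \<and> y' \<in> carrier N} \<union>
     {frag_of (r \<odot>\<^bsub>M\<^esub> x, y) - frag_of (x, r \<odot>\<^bsub>N\<^esub> y) | r x y.
        r \<in> carrier R \<and> x \<in> carrier M \<and> y \<in> carrier N} \<subseteq> carrier T"
      by (intro Un_least) (auto intro!: T_diff frag_of_T simp del: carrier_free_Abelian_group_iff)
  qed
  then have "inv\<^bsub>T\<^esub> a \<in> Rel" using assms by (rule subgroup.m_inv_closed)
  then show ?thesis using Rel_subset[OF assms] by (simp add: tensor_free_def)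
qed

lemma Rel_diff: "\<lbrakk>a \<in> Rel; b \<in> Rel\<rbrakk> \<Longrightarrow> a - b \<in> Rel"
  using Rel_add[OF _ Rel_uminus] by simp

lemma coset_eq_image: "Rel #>\<^bsub>T\<^esub> a = (\<lambda>r. r + a) ` Rel"
  by (auto simp: r_coset_def T_simps)

lemma coset_eq_iff: "Rel #>\<^bsub>T\<^esub> a = Rel #>\<^bsub>T\<^esub> b \<longleftrightarrow> a - b \<in> Rel"
proof
  assume "Rel #>\<^bsub>T\<^esub> a = Rel #>\<^bsub>T\<^esub> b"
  moreover have "a \<in> Rel #>\<^bsub>T\<^esub> a" unfolding coset_eq_image using Rel_zero by (metis add_0 imageI)
  ultimately obtain r where "r \<in> Rel" "a = r + b" unfolding coset_eq_image by auto
  then show "a - b \<in> Rel" by simp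
next
  assume ab: "a - b \<in> Rel"
  have "r + a \<in> (\<lambda>r. r + b) ` Rel" if "r \<in> Rel" for r
    using Rel_add[OF that ab] by (intro image_eqI[of _ _ "r + (a - b)"]) auto
  moreover have "r + b \<in> (\<lambda>r. r + a) ` Rel" if "r \<in> Rel" for r
    using Rel_diff[OF that ab] by (intro image_eqI[of _ _ "r - (a - b)"]) auto
  ultimately show "Rel #>\<^bsub>T\<^esub> a = Rel #>\<^bsub>T\<^esub> b" unfolding coset_eq_image by blast
qed

lemma coset_zero: "Rel #>\<^bsub>T\<^esub> 0 = Rel"
  by (simp add: coset_eq_image)

lemma carrier_tensor_product: "C \<in> carrier (tensor_product R M N) \<longleftrightarrow> (\<exists>c\<in>carrier T. C = Rel #>\<^bsub>T\<^esub> c)"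
  by (auto simp: tensor_product_def FactGroup_def RCOSETS_def)

lemma mult_tensor_product:
  "(Rel #>\<^bsub>T\<^esub> a) \<otimes>\<^bsub>tensor_product R M N\<^esub> (Rel #>\<^bsub>T\<^esub> b) = Rel #>\<^bsub>T\<^esub> (a + b)"
proof -
  have "{r + a + (r' + b) | r r'. r \<in> Rel \<and> r' \<in> Rel} = (\<lambda>r. r + (a + b)) ` Rel"
  proof (intro equalityI subsetI)
    fix z assume "z \<in> {r + a + (r' + b) | r r'. r \<in> Rel \<and> r' \<in> Rel}"
    then obtain r r' where r: "r \<in> Rel" "r' \<in> Rel" "z = r + a + (r' + b)" by blast
    then show "z \<in> (\<lambda>r. r + (a + b)) ` Rel"
      using Rel_add[OF r(1,2)] by (intro image_eqI[of _ _ "r + r'"]) (auto simp: algebra_simps)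
  next
    fix z assume "z \<in> (\<lambda>r. r + (a + b)) ` Rel"
    then obtain r where r: "r \<in> Rel" "z = r + a + (0 + b)" by (auto simp: algebra_simps)
    then show "z \<in> {r + a + (r' + b) | r r'. r \<in> Rel \<and> r' \<in> Rel}" using Rel_zero by blast
  qed
  then show ?thesis
    unfolding tensor_product_def FactGroup_def coset_eq_image
    by (simp add: set_mult_def T_simps) blast
qed

lemma one_tensor_product: "\<one>\<^bsub>tensor_product R M N\<^esub> = Rel #>\<^bsub>T\<^esub> 0"
  by (simp add: tensor_product_def FactGroup_def coset_zero)

lemma frag_of_zero_left: assumes "y \<in> carrier N" shows "frag_of (\<zero>\<^bsub>M\<^esub>, y) \<in> Rel"
  using Rel_uminus[OF Rel_generators(1)[of "\<zero>\<^bsub>M\<^esub>" "\<zero>\<^bsub>M\<^esub>" y]] assms by simp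

lemma frag_of_zero_right: assumes "x \<in> carrier M" shows "frag_of (x, \<zero>\<^bsub>N\<^esub>) \<in> Rel"
  using Rel_uminus[OF Rel_generators(2)[of x "\<zero>\<^bsub>N\<^esub>" "\<zero>\<^bsub>N\<^esub>"]] assms by simp

end

text \<open>The union in the definition of \<open>tensor_map\<close> collapses to a single coset because the map on
  representatives sends relations to relations.\<close>

lemma tensor_map_coset:
  assumes "tensor R M N" "tensor R M' N'"
    and f: "f \<in> module_hom R M M'" and g: "g \<in> module_hom R N N'"
  shows "tensor_map R M' N' f g (tensor_relations R M N #>\<^bsub>tensor_free M N\<^esub> c) =
    tensor_relations R M' N' #>\<^bsub>tensor_free M' N'\<^esub> frag_extend (\<lambda>(x, y). frag_of (f x, g y)) c"
proof -
  interpret A: tensor R M N by fact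
  interpret B: tensor R M' N' by fact
  let ?F = "frag_extend (\<lambda>(x, y). frag_of (f x, g y))"
  have F: "?F r \<in> B.Rel" if "r \<in> A.Rel" for r
  proof -
    have "r \<in> carrier A.T \<and> ?F r \<in> B.Rel"
      using A.M.module_axioms A.N.module_axioms that
    proof (induction rule: tensor_relations_induct)
      case (left x x' y)
      then show ?case
        using B.Rel_generators(1)[of "f x" "f x'" "g y"]
        by (simp add: frag_extend_diff module_homD[OF f] module_homD[OF g])
    next
      case (right x y y')
      then show ?case
        using B.Rel_generators(2)[of "f x" "g y" "g y'"]
        by (simp add: frag_extend_diff module_homD[OF f] module_homD[OF g])
    next
      case (balance r x y)
      then show ?case
        using B.Rel_generators(3)[of r "f x" "g y"]
        by (simp add: frag_extend_diff module_homD[OF f] module_homD[OF g])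
    qed (simp_all add: B.Rel_zero frag_extend_add B.Rel_add frag_extend_minus B.Rel_uminus)
    then show ?thesis ..
  qed
  have eq: "B.Rel #>\<^bsub>B.T\<^esub> ?F (r + c) = B.Rel #>\<^bsub>B.T\<^esub> ?F c" if "r \<in> A.Rel" for r
    using F[OF that] by (simp add: B.coset_eq_iff frag_extend_add)
  have "tensor_map R M' N' f g (A.Rel #>\<^bsub>A.T\<^esub> c) = (\<Union>r\<in>A.Rel. B.Rel #>\<^bsub>B.T\<^esub> ?F (r + c))"
    by (simp add: tensor_map_def A.coset_eq_image)
  also have "\<dots> = B.Rel #>\<^bsub>B.T\<^esub> ?F c"
    using eq A.Rel_zero by (metis (no_types, lifting) SUP_eq_const empty_iff)
  finally show ?thesis .
qed

text \<open>The isomorphism of \<open>R/I \<otimes> N\<close> with \<open>N/IN\<close> is used in the form that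
  \<open>p \<mapsto> 1 \<otimes> p\<close> is an additive surjection from \<open>N\<close> whose kernel is \<open>IN\<close>.\<close>

locale quotient_tensor = I: ideal I R + N: module R N
  for R :: "('a, 'r) ring_scheme" and I :: "'a set" and N :: "('a, 'c, 'n) module_scheme"
begin

abbreviation Q where "Q \<equiv> quot_module R I"

sublocale tensor R Q N
  by (intro tensor.intro quot_module_module N.module_axioms N.R.is_cring I.ideal_axioms)

definition unit_class :: "'a set" where "unit_class = I +>\<^bsub>R\<^esub> \<one>\<^bsub>R\<^esub>"

definition one_tensor :: "'c \<Rightarrow> ('a set \<times> 'c \<Rightarrow>\<^sub>0 int) set"
  where "one_tensor p = Rel #>\<^bsub>T\<^esub> frag_of (unit_class, p)"

lemma unit_class_closed: "unit_class \<in> carrier Q"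
  by (auto simp: unit_class_def I.carrier_quot_module)

lemma smult_unit_class: "a \<in> carrier R \<Longrightarrow> a \<odot>\<^bsub>Q\<^esub> unit_class = I +>\<^bsub>R\<^esub> a"
  by (simp add: unit_class_def I.quot_module_smult)

lemma one_tensor_add_Rel:
  assumes "p \<in> carrier N" "q \<in> carrier N"
  shows "frag_of (unit_class, p \<oplus>\<^bsub>N\<^esub> q) - (frag_of (unit_class, p) + frag_of (unit_class, q)) \<in> Rel"
  using Rel_generators(2)[OF unit_class_closed assms] by (simp add: algebra_simps)

lemma one_tensor_mult:
  assumes "p \<in> carrier N" "q \<in> carrier N"
  shows "one_tensor p \<otimes>\<^bsub>tensor_product R Q N\<^esub> one_tensor q = one_tensor (p \<oplus>\<^bsub>N\<^esub> q)"
  unfolding one_tensor_def mult_tensor_product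
  by (rule sym) (simp add: coset_eq_iff one_tensor_add_Rel[OF assms])

lemma one_tensor_zero: "one_tensor \<zero>\<^bsub>N\<^esub> = \<one>\<^bsub>tensor_product R Q N\<^esub>"
  unfolding one_tensor_def one_tensor_product coset_eq_iff
  using frag_of_zero_right[OF unit_class_closed] by simp

text \<open>A class \<open>a + I\<close> is \<open>a \<cdot> 1\<close>, so \<open>(a + I) \<otimes> y = 1 \<otimes> a y\<close>, and sums of such
  tensors can be collected in the second factor.\<close>

lemma one_tensor_surj:
  assumes "C \<in> carrier (tensor_product R Q N)"
  obtains p where "p \<in> carrier N" "C = one_tensor p"
proof -
  obtain c where c: "c \<in> carrier T" "C = Rel #>\<^bsub>T\<^esub> c"
    using assms by (auto simp: carrier_tensor_product)
  have "Poly_Mapping.keys c \<subseteq> carrier Q \<times> carrier N" using c(1) by (simp add: T_simps)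
  then have "\<exists>p\<in>carrier N. c - frag_of (unit_class, p) \<in> Rel"
  proof (induction c rule: frag_induction)
    case zero
    show ?case
      using Rel_uminus[OF frag_of_zero_right[OF unit_class_closed]] by (intro bexI[of _ "\<zero>\<^bsub>N\<^esub>"]) auto
  next
    case (one x)
    then obtain a y where x: "x = (I +>\<^bsub>R\<^esub> a, y)" "a \<in> carrier R" "y \<in> carrier N"
      by (auto simp: I.carrier_quot_module)
    then show ?case
      using Rel_generators(3)[OF x(2) unit_class_closed x(3)]
      by (intro bexI[of _ "a \<odot>\<^bsub>N\<^esub> y"]) (auto simp: smult_unit_class)
  next
    case (diff a b)
    then obtain p q where pq: "p \<in> carrier N" "q \<in> carrier N"
      "a - frag_of (unit_class, p) \<in> Rel" "b - frag_of (unit_class, q) \<in> Rel" by blast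
    have "frag_of (unit_class, p \<ominus>\<^bsub>N\<^esub> q \<oplus>\<^bsub>N\<^esub> q)
        - (frag_of (unit_class, p \<ominus>\<^bsub>N\<^esub> q) + frag_of (unit_class, q)) \<in> Rel"
      by (rule one_tensor_add_Rel) (use pq in auto)
    moreover have "p \<ominus>\<^bsub>N\<^esub> q \<oplus>\<^bsub>N\<^esub> q = p" using pq by (simp add: a_minus_def N.a_assoc N.l_neg)
    ultimately have "frag_of (unit_class, p) - (frag_of (unit_class, p \<ominus>\<^bsub>N\<^esub> q) + frag_of (unit_class, q)) \<in> Rel"
      by simp
    from Rel_add[OF Rel_diff[OF pq(3,4)] this]
    have "a - b - frag_of (unit_class, p \<ominus>\<^bsub>N\<^esub> q) \<in> Rel" by (simp add: algebra_simps)
    then show ?case using pq by blast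
  qed
  then show thesis using that c(2) by (auto simp: one_tensor_def coset_eq_iff)
qed

lemma one_tensor_closed: "p \<in> carrier N \<Longrightarrow> one_tensor p \<in> carrier (tensor_product R Q N)"
  using frag_of_T[OF unit_class_closed] by (auto simp: carrier_tensor_product one_tensor_def)

lemma frag_of_unit_class_Rel:
  assumes "p \<in> ideal_smult I N" shows "frag_of (unit_class, p) \<in> Rel"
  using assms
proof (induction rule: ideal_smult.induct)
  case (smult a x)
  have a: "a \<in> carrier R" by (rule I.Icarr[OF smult(1)])
  have "a \<odot>\<^bsub>Q\<^esub> unit_class = \<zero>\<^bsub>Q\<^esub>"
    using I.a_rcos_zero[OF I.ideal_axioms smult(1)] a
    by (simp add: smult_unit_class) (simp add: quot_module_def)
  then have "frag_of (\<zero>\<^bsub>Q\<^esub>, x) - frag_of (unit_class, a \<odot>\<^bsub>N\<^esub> x) \<in> Rel"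
    using Rel_generators(3)[OF a unit_class_closed smult(2)] by simp
  from Rel_diff[OF frag_of_zero_left[OF smult(2)] this] show ?case by simp
next
  case (add x y)
  then have "x \<in> carrier N" "y \<in> carrier N" using N.ideal_smult_closed[OF I.ideal_axioms] by auto
  from Rel_add[OF Rel_add[OF add(3,4)] one_tensor_add_Rel[OF this]] show ?case by simp
qed

text \<open>The kernel of \<open>p \<mapsto> 1 \<otimes> p\<close> is no larger than \<open>IN\<close>. To detect this, evaluate a formal
  sum by \<open>(C, y) \<mapsto> a y\<close>, where \<open>a\<close> is a chosen representative of the class
  \<open>C\<close>. A different choice changes the value by an element of \<open>IN\<close>, and therefore all
  relations are sent to \<open>IN\<close>.\<close>

lemma Rel_evaluation:
  obtains h where "h \<in> hom T (add_monoid N)" "\<And>r. r \<in> Rel \<Longrightarrow> h r \<in> ideal_smult I N"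
    "\<And>p. \<lbrakk>p \<in> carrier N; h (frag_of (unit_class, p)) \<in> ideal_smult I N\<rbrakk> \<Longrightarrow> p \<in> ideal_smult I N"
proof -
  define rep where "rep C = (SOME a. a \<in> carrier R \<and> C = I +>\<^bsub>R\<^esub> a)" for C
  have rep: "rep C \<in> carrier R \<and> C = I +>\<^bsub>R\<^esub> rep C" if "C \<in> carrier Q" for C
    unfolding rep_def by (rule someI_ex) (use that in \<open>auto simp: I.carrier_quot_module\<close>)
  have rep_cong: "rep C \<ominus>\<^bsub>R\<^esub> a \<in> I" if "C \<in> carrier Q" "C = I +>\<^bsub>R\<^esub> a" "a \<in> carrier R" for C a
    using rep[OF that(1)] that I.quotient_eq_iff_same_a_r_cos[OF I.ideal_axioms] by metis
  have NI: "a \<odot>\<^bsub>N\<^esub> y \<ominus>\<^bsub>N\<^esub> b \<odot>\<^bsub>N\<^esub> y \<in> ideal_smult I N"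
    if "a \<ominus>\<^bsub>R\<^esub> b \<in> I" "a \<in> carrier R" "b \<in> carrier R" "y \<in> carrier N" for a b y
  proof -
    have "a \<odot>\<^bsub>N\<^esub> y \<ominus>\<^bsub>N\<^esub> b \<odot>\<^bsub>N\<^esub> y = (a \<ominus>\<^bsub>R\<^esub> b) \<odot>\<^bsub>N\<^esub> y"
      using that by (simp add: a_minus_def N.smult_l_distr N.smult_l_minus)
    then show ?thesis using that by (simp add: ideal_smult.smult)
  qed
  obtain h where h: "h \<in> hom (free_Abelian_group (carrier Q \<times> carrier N)) (add_monoid N)"
    "\<And>x. x \<in> carrier Q \<times> carrier N \<Longrightarrow> h (frag_of x) = (case x of (C, y) \<Rightarrow> rep C \<odot>\<^bsub>N\<^esub> y)"
    by (rule comm_group.free_Abelian_group_universal[OF N.M.a_comm_group, where S = "carrier Q \<times> carrier N"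
          and f = "\<lambda>(C, y). rep C \<odot>\<^bsub>N\<^esub> y"]) (use rep in auto)
  have hT: "h \<in> hom T (add_monoid N)" using h(1) by (simp add: tensor_free_def)
  have h_closed: "h a \<in> carrier N" if "a \<in> carrier T" for a
    using hom_in_carrier[OF hT that] by simp
  have h_add: "h (a + b) = h a \<oplus>\<^bsub>N\<^esub> h b" if "a \<in> carrier T" "b \<in> carrier T" for a b
    using hom_mult[OF hT that] by (simp add: T_simps)
  have h_diff: "h (a - b) = h a \<ominus>\<^bsub>N\<^esub> h b" if "a \<in> carrier T" "b \<in> carrier T" for a b
    using h_add[OF T_diff[OF that] that(2)] h_closed[OF T_diff[OF that]] h_closed that
    by (simp add: a_minus_def N.M.a_assoc N.M.r_neg)
  have h_frag: "h (frag_of (C, y)) = rep C \<odot>\<^bsub>N\<^esub> y" if "C \<in> carrier Q" "y \<in> carrier N" for C y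
    using h(2)[of "(C, y)"] that by simp
  have zT: "0 \<in> carrier T" by (simp add: T_simps)
  have h_zero: "h 0 = \<zero>\<^bsub>N\<^esub>" using h_diff[OF zT zT] h_closed[OF zT] by simp
  have Rel: "r \<in> carrier T \<and> h r \<in> ideal_smult I N" if "r \<in> Rel" for r
    using M.module_axioms N.module_axioms that
  proof (induction rule: tensor_relations_induct)
    case zero
    then show ?case by (simp add: h_zero N.zero_ideal_smult[OF I.ideal_axioms])
  next
    case (add a b)
    then show ?case by (simp add: h_add ideal_smult.add)
  next
    case (uminus a)
    then show ?case
      using h_diff[OF zT uminus(1)] h_closed[OF uminus(1)]
      by (simp add: h_zero a_minus_def N.a_inv_ideal_smult[OF I.ideal_axioms])
  next
    case (left C C' y)
    note cl = rep[OF left(1)] rep[OF left(2)] rep[OF M.M.a_closed[OF left(1,2)]]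
    have sum: "C \<oplus>\<^bsub>Q\<^esub> C' = I +>\<^bsub>R\<^esub> (rep C \<oplus>\<^bsub>R\<^esub> rep C')"
      using cl I.quot_module_add[of "rep C" "rep C'"] by metis
    have "rep (C \<oplus>\<^bsub>Q\<^esub> C') \<ominus>\<^bsub>R\<^esub> (rep C \<oplus>\<^bsub>R\<^esub> rep C') \<in> I"
      by (rule rep_cong[OF M.M.a_closed[OF left(1,2)] sum]) (use cl in simp)
    then have "rep (C \<oplus>\<^bsub>Q\<^esub> C') \<odot>\<^bsub>N\<^esub> y \<ominus>\<^bsub>N\<^esub> (rep C \<oplus>\<^bsub>R\<^esub> rep C') \<odot>\<^bsub>N\<^esub> y \<in> ideal_smult I N"
      using cl left by (intro NI) auto
    moreover have "h (frag_of (C \<oplus>\<^bsub>Q\<^esub> C', y) - frag_of (C, y) - frag_of (C', y)) =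
        rep (C \<oplus>\<^bsub>Q\<^esub> C') \<odot>\<^bsub>N\<^esub> y \<ominus>\<^bsub>N\<^esub> (rep C \<oplus>\<^bsub>R\<^esub> rep C') \<odot>\<^bsub>N\<^esub> y"
      using left cl by (simp add: h_diff h_frag T_diff frag_of_T N.smult_l_distr a_minus_def
          N.M.minus_add N.M.a_assoc)
    ultimately show ?case by simp
  next
    case (right C y y')
    have "h (frag_of (C, y \<oplus>\<^bsub>N\<^esub> y') - frag_of (C, y) - frag_of (C, y')) = \<zero>\<^bsub>N\<^esub>"
      using right rep[OF right(1)] by (simp add: h_diff h_frag T_diff frag_of_T N.smult_r_distr a_minus_def
          N.M.a_ac N.M.r_neg N.M.r_neg1 N.M.r_neg2)
    then show ?case by (simp add: N.zero_ideal_smult[OF I.ideal_axioms])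
  next
    case (balance r C y)
    note cl = rep[OF balance(2)] rep[OF M.smult_closed[OF balance(1,2)]]
    have prod: "r \<odot>\<^bsub>Q\<^esub> C = I +>\<^bsub>R\<^esub> (r \<otimes>\<^bsub>R\<^esub> rep C)"
      using cl I.quot_module_smult[of r "rep C"] balance by metis
    have "rep (r \<odot>\<^bsub>Q\<^esub> C) \<ominus>\<^bsub>R\<^esub> (r \<otimes>\<^bsub>R\<^esub> rep C) \<in> I"
      by (rule rep_cong[OF M.smult_closed[OF balance(1,2)] prod]) (use cl balance in simp)
    then have "rep (r \<odot>\<^bsub>Q\<^esub> C) \<odot>\<^bsub>N\<^esub> y \<ominus>\<^bsub>N\<^esub> (r \<otimes>\<^bsub>R\<^esub> rep C) \<odot>\<^bsub>N\<^esub> y \<in> ideal_smult I N"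
      using cl balance by (intro NI) auto
    moreover have "(r \<otimes>\<^bsub>R\<^esub> rep C) \<odot>\<^bsub>N\<^esub> y = rep C \<odot>\<^bsub>N\<^esub> (r \<odot>\<^bsub>N\<^esub> y)"
      using cl balance by (metis N.R.m_comm N.smult_assoc1)
    ultimately show ?case using balance by (simp add: h_diff h_frag frag_of_T)
  qed
  show thesis
  proof (rule that[OF hT])
    fix p assume p: "p \<in> carrier N" "h (frag_of (unit_class, p)) \<in> ideal_smult I N"
    have u: "rep unit_class \<in> carrier R" using rep[OF unit_class_closed] by simp
    have "rep unit_class \<odot>\<^bsub>N\<^esub> p \<ominus>\<^bsub>N\<^esub> \<one>\<^bsub>R\<^esub> \<odot>\<^bsub>N\<^esub> p \<in> ideal_smult I N"
      by (rule NI) (use p u rep_cong[OF unit_class_closed unit_class_def] in auto)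
    from N.minus_ideal_smult[OF I.ideal_axioms p(2) this]
    show "p \<in> ideal_smult I N"
      using p u by (simp add: h_frag unit_class_closed a_minus_def N.M.minus_add N.M.r_neg2)
  qed (use Rel in blast)
qed

lemma one_tensor_eq_iff:
  assumes "p \<in> carrier N" "q \<in> carrier N"
  shows "one_tensor p = one_tensor q \<longleftrightarrow> p \<ominus>\<^bsub>N\<^esub> q \<in> ideal_smult I N"
proof -
  let ?e = "\<lambda>p. frag_of (unit_class, p)"
  have eq: "p \<ominus>\<^bsub>N\<^esub> q \<oplus>\<^bsub>N\<^esub> q = p" using assms by (simp add: a_minus_def N.M.a_assoc N.M.l_neg)
  have 1: "?e p - (?e (p \<ominus>\<^bsub>N\<^esub> q) + ?e q) \<in> Rel"
    using one_tensor_add_Rel[of "p \<ominus>\<^bsub>N\<^esub> q" q] assms by (simp add: eq)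
  have "one_tensor p = one_tensor q \<longleftrightarrow> ?e (p \<ominus>\<^bsub>N\<^esub> q) \<in> Rel"
    unfolding one_tensor_def coset_eq_iff using Rel_add[OF 1, of "?e (p \<ominus>\<^bsub>N\<^esub> q)"] Rel_diff[OF _ 1, of "?e p - ?e q"]
    by (auto simp: algebra_simps)
  also have "\<dots> \<longleftrightarrow> p \<ominus>\<^bsub>N\<^esub> q \<in> ideal_smult I N"
    by (rule Rel_evaluation) (use assms frag_of_unit_class_Rel in blast)
  finally show ?thesis .
qed

end

lemma tensor_map_one_tensor:
  assumes "quotient_tensor R I N" "quotient_tensor R J N'" "I \<subseteq> J" "g \<in> module_hom R N N'"
    and f: "f \<in> module_hom R (quot_module R I) (quot_module R J)" 
      "f (I +>\<^bsub>R\<^esub> \<one>\<^bsub>R\<^esub>) = J +>\<^bsub>R\<^esub> \<one>\<^bsub>R\<^esub>"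
  shows "tensor_map R (quot_module R J) N' f g (quotient_tensor.one_tensor R I N p) = 
    quotient_tensor.one_tensor R J N' (g p)"
proof -
  interpret I: quotient_tensor R I N by fact
  interpret J: quotient_tensor R J N' by fact
  show ?thesis
    unfolding I.one_tensor_def J.one_tensor_def
    by (subst tensor_map_coset[OF I.tensor_axioms J.tensor_axioms f(1) assms(4)])
       (simp add: I.unit_class_def J.unit_class_def f(2))
qed

text \<open>Under \<open>p \<mapsto> 1 \<otimes> p\<close> a cycle of \<open>R/I \<otimes> P\<close> is a chain \<open>p\<close> with boundary in
  \<open>I P\<close>, and the map to \<open>R/J \<otimes> P\<close> becomes the identity on representatives. The
  vanishing on homology thus reduces to a statement about chains of \<open>P\<close>. Members of a homology
  class and the cosets of the boundary group are both handled by the additivity of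
  \<open>p \<mapsto> 1 \<otimes> p\<close>.\<close>

lemma Tor_map_zero:
  assumes "cring R" and I: "ideal I R" and J: "ideal J R" and IJ: "I \<subseteq> J"
    and P: "\<And>n. module R (P n)"
    and \<delta>: "\<And>n. \<delta> n \<in> module_hom R (P (Suc n)) (P n)"
    and \<delta>\<delta>: "\<And>x. x \<in> carrier (P (Suc (Suc n))) \<Longrightarrow> \<delta> n (\<delta> (Suc n) x) = \<zero>\<^bsub>P n\<^esub>"
    and key: "\<And>p. \<lbrakk>p \<in> carrier (P (Suc n)); \<delta> n p \<in> ideal_smult I (P n)\<rbrakk>
      \<Longrightarrow> \<exists>q\<in>carrier (P (Suc (Suc n))). p \<ominus>\<^bsub>P (Suc n)\<^esub> \<delta> (Suc n) q \<in> ideal_smult J (P (Suc n))"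
  shows "zero_map (Tor R (quot_module R I) P \<delta> (Suc n)) (Tor R (quot_module R J) P \<delta> (Suc n))
    (Tor_map R (quot_module R J) P \<delta> (quot_proj R J) (Suc n))"
proof -
  interpret cring R by fact
  interpret Pn: module R "P m" for m by (rule P)
  have qt: "quotient_tensor R I (P m)" "quotient_tensor R J (P m)" for m
    using I J P by (simp_all add: quotient_tensor_def)
  interpret I: quotient_tensor R I "P m" for m by (rule qt)
  interpret J: quotient_tensor R J "P m" for m by (rule qt)
  let ?TI = "\<lambda>m. tensor_product R (quot_module R I) (P m)"
  let ?TJ = "\<lambda>m. tensor_product R (quot_module R J) (P m)"
  let ?DI = "\<lambda>m. tensor_map R (quot_module R I) (P m) id (\<delta> m)"
  let ?DJ = "\<lambda>m. tensor_map R (quot_module R J) (P m) id (\<delta> m)"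
  let ?f = "\<lambda>m. tensor_map R (quot_module R J) (P m) (quot_proj R J) id"
  have idh: "id \<in> module_hom R M M" for M :: "('a, 'x, 'y) module_scheme" by (simp add: module_homI)
  have DI: "?DI m (I.one_tensor (Suc m) p) = I.one_tensor m (\<delta> m p)" for m p
    by (rule tensor_map_one_tensor[OF qt(1) qt(1) _ \<delta> idh]) auto
  have DJ: "?DJ m (J.one_tensor (Suc m) p) = J.one_tensor m (\<delta> m p)" for m p
    by (rule tensor_map_one_tensor[OF qt(2) qt(2) _ \<delta> idh]) auto
  have f: "?f m (I.one_tensor m p) = J.one_tensor m p" for m p
    using tensor_map_one_tensor[OF qt(1) qt(2) IJ idh quot_proj_module_hom[OF assms(1) I J IJ]
        quot_proj_coset[OF assms(1) I J IJ], of m p] by simp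
  note \<delta>_closed = module_hom_closed[OF \<delta>]
  let ?BJ = "boundaries ?TJ ?DJ (Suc n)"
  have BJ: "?BJ = (\<lambda>q. J.one_tensor (Suc n) (\<delta> (Suc n) q)) ` carrier (P (Suc (Suc n)))"
  proof (intro equalityI subsetI)
    fix b assume "b \<in> ?BJ"
    then obtain C where "C \<in> carrier (?TJ (Suc (Suc n)))" "b = ?DJ (Suc n) C"
      by (auto simp: boundaries_def)
    then show "b \<in> (\<lambda>q. J.one_tensor (Suc n) (\<delta> (Suc n) q)) ` carrier (P (Suc (Suc n)))"
      using J.one_tensor_surj[of C "Suc (Suc n)"] DJ by (metis imageI)
  next
    fix b assume "b \<in> (\<lambda>q. J.one_tensor (Suc n) (\<delta> (Suc n) q)) ` carrier (P (Suc (Suc n)))"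
    then show "b \<in> ?BJ" unfolding boundaries_def using J.one_tensor_closed DJ by force
  qed
  have abs: "?BJ #>\<^bsub>?TJ (Suc n)\<^esub> J.one_tensor (Suc n) (\<delta> (Suc n) v) = ?BJ"
    if v: "v \<in> carrier (P (Suc (Suc n)))" for v
  proof -
    have mult: "J.one_tensor (Suc n) (\<delta> (Suc n) q) \<otimes>\<^bsub>?TJ (Suc n)\<^esub> J.one_tensor (Suc n) (\<delta> (Suc n) v)
        = J.one_tensor (Suc n) (\<delta> (Suc n) (q \<oplus>\<^bsub>P (Suc (Suc n))\<^esub> v))"
      if "q \<in> carrier (P (Suc (Suc n)))" for q
      using that v by (simp add: J.one_tensor_mult \<delta>_closed module_hom_add[OF \<delta>])
    have "?BJ #>\<^bsub>?TJ (Suc n)\<^esub> J.one_tensor (Suc n) (\<delta> (Suc n) v) =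
      (\<lambda>q. J.one_tensor (Suc n) (\<delta> (Suc n) (q \<oplus>\<^bsub>P (Suc (Suc n))\<^esub> v))) ` carrier (P (Suc (Suc n)))"
      unfolding r_coset_def BJ using mult by auto
    also have "\<dots> = (\<lambda>q. J.one_tensor (Suc n) (\<delta> (Suc n) q)) ` ((\<lambda>q. q \<oplus>\<^bsub>P (Suc (Suc n))\<^esub> v) ` carrier (P (Suc (Suc n))))"
      by (simp add: image_image)
    also have "(\<lambda>q. q \<oplus>\<^bsub>P (Suc (Suc n))\<^esub> v) ` carrier (P (Suc (Suc n))) = carrier (P (Suc (Suc n)))"
    proof (intro equalityI subsetI)
      fix q assume q: "q \<in> carrier (P (Suc (Suc n)))"
      then show "q \<in> (\<lambda>q. q \<oplus>\<^bsub>P (Suc (Suc n))\<^esub> v) ` carrier (P (Suc (Suc n)))"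
        using v by (intro image_eqI[of _ _ "q \<ominus>\<^bsub>P (Suc (Suc n))\<^esub> v"])
          (auto simp: a_minus_def Pn.M.a_assoc Pn.M.l_neg)
    qed (use v in auto)
    finally show ?thesis by (simp only: BJ)
  qed
  have cycle: "?f (Suc n) (I.one_tensor (Suc n) p) \<in> (\<lambda>v. J.one_tensor (Suc n) (\<delta> (Suc n) v)) ` carrier (P (Suc (Suc n)))"
    if p: "p \<in> carrier (P (Suc n))" and zero: "\<delta> n p \<in> ideal_smult I (P n)" for p
  proof -
    obtain v where v: "v \<in> carrier (P (Suc (Suc n)))"
        "p \<ominus>\<^bsub>P (Suc n)\<^esub> \<delta> (Suc n) v \<in> ideal_smult J (P (Suc n))"
      using key[OF p zero] by blast
    then have "J.one_tensor (Suc n) p = J.one_tensor (Suc n) (\<delta> (Suc n) v)"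
      using J.one_tensor_eq_iff p \<delta>_closed by blast
    then show ?thesis using v(1) f by auto
  qed
  show ?thesis
    unfolding zero_map_def
  proof
    fix Z assume "Z \<in> carrier (Tor R (quot_module R I) P \<delta> (Suc n))"
    then obtain z where z: "z \<in> kernel (?TI (Suc n)) (?TI n) (?DI n)"
      and Z: "Z = boundaries ?TI ?DI (Suc n) #>\<^bsub>?TI (Suc n)\<^esub> z"
      by (auto simp: Tor_def homology_def FactGroup_def RCOSETS_def cycles_def r_coset_def)
    obtain p where p: "p \<in> carrier (P (Suc n))" "z = I.one_tensor (Suc n) p"
      using z by (auto simp: kernel_def elim: I.one_tensor_surj)
    have "I.one_tensor n (\<delta> n p) = I.one_tensor n \<zero>\<^bsub>P n\<^esub>"
      using z p DI I.one_tensor_zero by (simp add: kernel_def)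
    then have \<delta>p: "\<delta> n p \<in> ideal_smult I (P n)"
      using I.one_tensor_eq_iff[of "\<delta> n p" n "\<zero>\<^bsub>P n\<^esub>"] \<delta>_closed[OF p(1)] by (simp add: Pn.M.minus_zero_right)
    have X_elt: "?BJ #>\<^bsub>?TJ (Suc n)\<^esub> ?f (Suc n) y = ?BJ" if y: "y \<in> Z" for y
    proof -
      obtain C where "C \<in> carrier (?TI (Suc (Suc n)))" "y = ?DI (Suc n) C \<otimes>\<^bsub>?TI (Suc n)\<^esub> z"
        using y by (auto simp: Z r_coset_def boundaries_def)
      then obtain q where q: "q \<in> carrier (P (Suc (Suc n)))"
          "y = I.one_tensor (Suc n) (\<delta> (Suc n) q) \<otimes>\<^bsub>?TI (Suc n)\<^esub> I.one_tensor (Suc n) p"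
        using I.one_tensor_surj[of C "Suc (Suc n)"] DI p by metis
      then have y_eq: "y = I.one_tensor (Suc n) (\<delta> (Suc n) q \<oplus>\<^bsub>P (Suc n)\<^esub> p)"
        using p \<delta>_closed by (simp add: I.one_tensor_mult)
      have "\<delta> n (\<delta> (Suc n) q \<oplus>\<^bsub>P (Suc n)\<^esub> p) = \<delta> n p"
        using p q \<delta>_closed by (simp add: module_hom_add[OF \<delta>] \<delta>\<delta>)
      then have "?f (Suc n) y \<in> (\<lambda>v. J.one_tensor (Suc n) (\<delta> (Suc n) v)) ` carrier (P (Suc (Suc n)))"
        unfolding y_eq by (intro cycle) (use p q \<delta>_closed \<delta>p in auto)
      then show ?thesis using abs by auto
    qed
    have "?DI (Suc n) (I.one_tensor (Suc (Suc n)) \<zero>\<^bsub>P (Suc (Suc n))\<^esub>) \<otimes>\<^bsub>?TI (Suc n)\<^esub> z \<in> Z"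
      unfolding Z r_coset_def boundaries_def using I.one_tensor_closed by blast
    then have "(\<Union>y\<in>Z. ?BJ #>\<^bsub>?TJ (Suc n)\<^esub> ?f (Suc n) y) = ?BJ" using X_elt by blast
    then show "Tor_map R (quot_module R J) P \<delta> (quot_proj R J) (Suc n) Z =
        \<one>\<^bsub>Tor R (quot_module R J) P \<delta> (Suc n)\<^esub>"
      by (simp add: Tor_map_def homology_map_def Tor_def homology_def FactGroup_def)
  qed
qed

section \<open>Gradings and derivatives in the polynomial ring\<close>

lemma lookup_single_times:
  fixes p :: "('a::cancel_comm_monoid_add \<Rightarrow>\<^sub>0 'k::comm_semiring_1)"
  shows "Poly_Mapping.lookup (Poly_Mapping.single a c * p) (a + m) = c * Poly_Mapping.lookup p m"
proof -
  have "Poly_Mapping.lookup (Poly_Mapping.single a c * p) (a + m) =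
      (\<Sum>l. (c * (\<Sum>q. Poly_Mapping.lookup p q when a + m = l + q)) when a = l)"
    unfolding lookup_mult lookup_single by (simp add: when_mult)
  also have "\<dots> = c * (\<Sum>q. Poly_Mapping.lookup p q when m = q)" by simp
  finally show ?thesis by simp
qed

lemma lookup_single_times_eq_0:
  fixes p :: "('a::cancel_comm_monoid_add \<Rightarrow>\<^sub>0 'k::comm_semiring_1)"
  assumes "\<And>m. k \<noteq> a + m"
  shows "Poly_Mapping.lookup (Poly_Mapping.single a c * p) k = 0"
proof -
  have "Poly_Mapping.lookup (Poly_Mapping.single a c * p) k =
      (\<Sum>l. (c * (\<Sum>q. Poly_Mapping.lookup p q when k = l + q)) when a = l)"
    unfolding lookup_mult lookup_single by (simp add: when_mult)
  also have "\<dots> = 0" using assms by simp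
  finally show ?thesis .
qed

lemma exponent_decompose:
  "Poly_Mapping.lookup m j > 0 \<Longrightarrow> (m::nat \<Rightarrow>\<^sub>0 nat) = Poly_Mapping.single j 1 + (m - Poly_Mapping.single j 1)"
  by (rule poly_mapping_eqI) (auto simp: lookup_add lookup_minus lookup_single when_def)

lemma lookup_mvar_times:
  "Poly_Mapping.lookup (mvar j * p) m =
    (if Poly_Mapping.lookup m j > 0 then Poly_Mapping.lookup p (m - Poly_Mapping.single j 1) else 0)"
proof (cases "Poly_Mapping.lookup m j > 0")
  case True
  then show ?thesis
    using lookup_single_times[of "Poly_Mapping.single j 1" 1 p "m - Poly_Mapping.single j 1"]
    by (simp add: mvar_def exponent_decompose[OF True, symmetric] del: One_nat_def)
next
  case False
  then have "m \<noteq> Poly_Mapping.single j 1 + m'" for m' by (auto simp: lookup_add)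
  then show ?thesis using False by (simp add: mvar_def lookup_single_times_eq_0)
qed

lemma lookup_hom_component:
  "Poly_Mapping.lookup (hom_component n p) m = (if monom_deg m = n then Poly_Mapping.lookup p m else 0)"
proof -
  have "Poly_Mapping.lookup (hom_component n p) m =
    (\<Sum>m'\<in>{m' \<in> Poly_Mapping.keys p. monom_deg m' = n}. if m' = m then Poly_Mapping.lookup p m' else 0)"
    unfolding hom_component_def by (simp add: lookup_sum lookup_single when_def)
  then show ?thesis by (simp add: in_keys_iff)
qed

lemma lookup_partial_deriv:
  "Poly_Mapping.lookup (partial_deriv j p) m =
    of_nat (Poly_Mapping.lookup m j + 1) * Poly_Mapping.lookup p (m + Poly_Mapping.single j 1)"
proof -
  have "Poly_Mapping.lookup (partial_deriv j p) m = (\<Sum>m'\<in>Poly_Mapping.keys p.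
      if m' = m + Poly_Mapping.single j 1 then of_nat (Poly_Mapping.lookup m' j) * Poly_Mapping.lookup p m' else 0)"
    unfolding partial_deriv_def lookup_sum
  proof (rule sum.cong[OF refl])
    fix m' :: "nat \<Rightarrow>\<^sub>0 nat"
    have "m' - Poly_Mapping.single j 1 = m \<and> Poly_Mapping.lookup m' j > 0 \<longleftrightarrow> m' = m + Poly_Mapping.single j 1"
      using exponent_decompose[of m' j] by (auto simp: lookup_add add.commute)
    then show "Poly_Mapping.lookup (Poly_Mapping.single (m' - Poly_Mapping.single j 1)
        (of_nat (Poly_Mapping.lookup m' j) * Poly_Mapping.lookup p m')) m =
       (if m' = m + Poly_Mapping.single j 1 then of_nat (Poly_Mapping.lookup m' j) * Poly_Mapping.lookup p m' else 0)"
      by (cases "Poly_Mapping.lookup m' j = 0") (auto simp: lookup_single when_def lookup_add)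
  qed
  then show ?thesis by (simp add: in_keys_iff lookup_add)
qed

lemma hom_component_add: "hom_component n (p + q) = hom_component n p + hom_component n q"
  by (rule poly_mapping_eqI) (simp add: lookup_hom_component lookup_add)

lemma hom_component_0 [simp]: "hom_component n 0 = 0"
  by (rule poly_mapping_eqI) (simp add: lookup_hom_component)

lemma hom_component_uminus: "hom_component n (- p) = - hom_component n p"
  by (rule poly_mapping_eqI) (simp add: lookup_hom_component)

lemma hom_component_sum: "hom_component n (\<Sum>i\<in>S. f i) = (\<Sum>i\<in>S. hom_component n (f i))"
  by (induction S rule: infinite_finite_induct) (simp_all add: hom_component_add)

lemma sum_hom_component:
  assumes "finite E" "monom_deg ` Poly_Mapping.keys p \<subseteq> E"
  shows "(\<Sum>e\<in>E. hom_component e p) = p"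
  by (rule poly_mapping_eqI)
     (use assms in \<open>auto simp: lookup_sum lookup_hom_component in_keys_iff image_subset_iff\<close>)

lemma partial_deriv_add: "partial_deriv j (p + q) = partial_deriv j p + partial_deriv j q"
  by (rule poly_mapping_eqI) (simp add: lookup_partial_deriv lookup_add algebra_simps)

lemma partial_deriv_0 [simp]: "partial_deriv j 0 = 0"
  by (rule poly_mapping_eqI) (simp add: lookup_partial_deriv)

lemma partial_deriv_uminus: "partial_deriv j (- p) = - partial_deriv j p"
  by (rule poly_mapping_eqI) (simp add: lookup_partial_deriv)

lemma partial_deriv_sum: "partial_deriv j (\<Sum>i\<in>S. f i) = (\<Sum>i\<in>S. partial_deriv j (f i))"
  by (induction S rule: infinite_finite_induct) (simp_all add: partial_deriv_add)

lemma mpoly_induct [case_names zero single add]: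
  fixes p :: "'a \<Rightarrow>\<^sub>0 'b::comm_monoid_add"
  assumes "P 0" "\<And>m c. P (Poly_Mapping.single m c)" "\<And>p q. \<lbrakk>P p; P q\<rbrakk> \<Longrightarrow> P (p + q)"
  shows "P p"
proof -
  have "P (\<Sum>m\<in>S. Poly_Mapping.single m (Poly_Mapping.lookup p m))" for S
    by (induction S rule: infinite_finite_induct) (simp_all add: assms)
  moreover have "(\<Sum>m\<in>Poly_Mapping.keys p. Poly_Mapping.single m (Poly_Mapping.lookup p m)) = p"
    by (rule poly_mapping_eqI) (simp add: lookup_sum lookup_single when_def in_keys_iff)
  ultimately show ?thesis by metis
qed

lemma partial_deriv_single:
  "partial_deriv j (Poly_Mapping.single m c) =
    Poly_Mapping.single (m - Poly_Mapping.single j 1) (of_nat (Poly_Mapping.lookup m j) * c)"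
  by (cases "c = 0") (simp_all add: partial_deriv_def)

lemma partial_deriv_mult: "partial_deriv j (p * q) = partial_deriv j p * q + p * partial_deriv j q"
proof (induction p rule: mpoly_induct)
  case (single m c)
  show ?case
  proof (induction q rule: mpoly_induct)
    case (single m' c')
    let ?e = "Poly_Mapping.single j (1::nat)"
    have 1: "m + m' - ?e = m - ?e + m'" if "Poly_Mapping.lookup m j \<noteq> 0"
      by (rule poly_mapping_eqI) (use that in \<open>auto simp: lookup_add lookup_minus lookup_single when_def\<close>)
    have 2: "m + m' - ?e = m + (m' - ?e)" if "Poly_Mapping.lookup m' j \<noteq> 0"
      by (rule poly_mapping_eqI) (use that in \<open>auto simp: lookup_add lookup_minus lookup_single when_def\<close>)
    show ?case
      using 1 2
      by (cases "Poly_Mapping.lookup m j = 0"; cases "Poly_Mapping.lookup m' j = 0")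
         (simp_all add: mult_single partial_deriv_single lookup_add single_add[symmetric] algebra_simps)
  qed (simp_all add: partial_deriv_add algebra_simps)
qed (simp_all add: partial_deriv_add algebra_simps)

lemma partial_deriv_mvar_times:
  "partial_deriv l (mvar j * p) = mvar j * partial_deriv l p + (if l = j then p else 0)"
  by (simp add: partial_deriv_mult mvar_def partial_deriv_single lookup_single when_def)

lemma monom_deg_eq: "\<lbrakk>finite S; Poly_Mapping.keys m \<subseteq> S\<rbrakk> \<Longrightarrow> monom_deg m = (\<Sum>j\<in>S. Poly_Mapping.lookup m j)"
  unfolding monom_deg_def by (rule sum.mono_neutral_left) (auto simp: in_keys_iff)

lemma monom_deg_add: "monom_deg (m + m') = monom_deg m + monom_deg m'"
proof -
  let ?S = "Poly_Mapping.keys m \<union> Poly_Mapping.keys m'"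
  have "Poly_Mapping.keys (m + m') \<subseteq> ?S" by (rule keys_add)
  then show ?thesis by (simp add: monom_deg_eq[of ?S] lookup_add sum.distrib)
qed

lemma monom_deg_0 [simp]: "monom_deg 0 = 0"
  by (simp add: monom_deg_def)

lemma monom_deg_eq_0_iff: "monom_deg m = 0 \<longleftrightarrow> m = 0"
proof
  assume "monom_deg m = 0"
  then have "Poly_Mapping.lookup m j = 0" for j
    unfolding monom_deg_def by (cases "j \<in> Poly_Mapping.keys m") (auto simp: in_keys_iff)
  then show "m = 0" by (intro poly_mapping_eqI) simp
qed simp

lemma hom_component_Suc_mvar_times: "hom_component (Suc e) (mvar j * p) = mvar j * hom_component e p"
proof (rule poly_mapping_eqI)
  fix m :: "nat \<Rightarrow>\<^sub>0 nat"
  have "monom_deg m = Suc (monom_deg (m - Poly_Mapping.single j 1))" if "Poly_Mapping.lookup m j > 0"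
    by (subst exponent_decompose[OF that], subst monom_deg_add) (simp add: monom_deg_def)
  then show "Poly_Mapping.lookup (hom_component (Suc e) (mvar j * p)) m =
      Poly_Mapping.lookup (mvar j * hom_component e p) m"
    by (simp add: lookup_hom_component lookup_mvar_times)
qed

lemma carrier_mpoly_ring:
  "p \<in> carrier (mpoly_ring d) \<longleftrightarrow> (\<forall>m. Poly_Mapping.lookup p m \<noteq> 0 \<longrightarrow> Poly_Mapping.keys m \<subseteq> {1..d})"
  by (auto simp: mpoly_ring_def in_keys_iff)

lemma mpoly_ring_simps [simp]:
  "\<zero>\<^bsub>mpoly_ring d\<^esub> = 0" "\<one>\<^bsub>mpoly_ring d\<^esub> = 1"
  "p \<oplus>\<^bsub>mpoly_ring d\<^esub> q = p + q" "p \<otimes>\<^bsub>mpoly_ring d\<^esub> q = p * q"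
  by (simp_all add: mpoly_ring_def)

lemma mpoly_carrier_0: "0 \<in> carrier (mpoly_ring d)"
  by (simp add: carrier_mpoly_ring)

lemma mpoly_carrier_add:
  "\<lbrakk>p \<in> carrier (mpoly_ring d); q \<in> carrier (mpoly_ring d)\<rbrakk> \<Longrightarrow> p + q \<in> carrier (mpoly_ring d)"
  unfolding carrier_mpoly_ring lookup_add by (metis add_0)

lemma mpoly_carrier_uminus: "p \<in> carrier (mpoly_ring d) \<Longrightarrow> - p \<in> carrier (mpoly_ring d)"
  by (simp add: carrier_mpoly_ring)

lemma mpoly_carrier_single: "Poly_Mapping.keys m \<subseteq> {1..d} \<Longrightarrow> Poly_Mapping.single m c \<in> carrier (mpoly_ring d)"
  by (simp add: carrier_mpoly_ring lookup_single when_def)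

lemma mpoly_carrier_mult:
  assumes "p \<in> carrier (mpoly_ring d)" "q \<in> carrier (mpoly_ring d)"
  shows "p * q \<in> carrier (mpoly_ring d)"
proof -
  have "Poly_Mapping.keys m \<subseteq> {1..d}" if m: "m \<in> Poly_Mapping.keys (p * q)" for m
  proof -
    obtain a b where "m = a + b" "a \<in> Poly_Mapping.keys p" "b \<in> Poly_Mapping.keys q"
      using subsetD[OF keys_mult m] by blast
    moreover have "Poly_Mapping.keys (a + b) \<subseteq> Poly_Mapping.keys a \<union> Poly_Mapping.keys b"
      by (rule keys_add)
    moreover have "Poly_Mapping.keys a \<subseteq> {1..d}" "Poly_Mapping.keys b \<subseteq> {1..d}"
      using assms calculation(2,3) by (simp_all add: mpoly_ring_def)
    ultimately show ?thesis by blast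
  qed
  then show ?thesis by (simp add: mpoly_ring_def)
qed

lemma mpoly_carrier_1: "1 \<in> carrier (mpoly_ring d)"
  using mpoly_carrier_single[of 0 d 1] by simp

lemma mpoly_carrier_mvar: "j \<in> {1..d} \<Longrightarrow> mvar j \<in> carrier (mpoly_ring d)"
  unfolding mvar_def by (rule mpoly_carrier_single) simp

lemma mpoly_carrier_hom_component: "p \<in> carrier (mpoly_ring d) \<Longrightarrow> hom_component n p \<in> carrier (mpoly_ring d)"
  by (simp add: carrier_mpoly_ring lookup_hom_component)

lemma mpoly_carrier_partial_deriv:
  assumes "p \<in> carrier (mpoly_ring d)" shows "partial_deriv j p \<in> carrier (mpoly_ring d)"
  unfolding carrier_mpoly_ring lookup_partial_deriv
proof (intro allI impI)
  fix m assume "of_nat (Poly_Mapping.lookup m j + 1) * Poly_Mapping.lookup p (m + Poly_Mapping.single j 1) \<noteq> 0"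
  then have "Poly_Mapping.lookup p (m + Poly_Mapping.single j 1) \<noteq> 0" by auto
  then have "Poly_Mapping.keys (m + Poly_Mapping.single j 1) \<subseteq> {1..d}"
    using assms unfolding carrier_mpoly_ring by blast
  moreover have "Poly_Mapping.keys m \<subseteq> Poly_Mapping.keys (m + Poly_Mapping.single j 1)"
    by (auto simp: in_keys_iff lookup_add)
  ultimately show "Poly_Mapping.keys m \<subseteq> {1..d}" by blast
qed

lemma mpoly_carrier_sum:
  "(\<And>i. i \<in> S \<Longrightarrow> f i \<in> carrier (mpoly_ring d)) \<Longrightarrow> (\<Sum>i\<in>S. f i) \<in> carrier (mpoly_ring d)"
  by (induction S rule: infinite_finite_induct) (simp_all add: mpoly_carrier_0 mpoly_carrier_add)

lemma cring_mpoly_ring: "cring (mpoly_ring d)"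
proof (rule cringI)
  show "abelian_group (mpoly_ring d)"
  proof (rule abelian_groupI)
    fix p assume "p \<in> carrier (mpoly_ring d)"
    then show "\<exists>q\<in>carrier (mpoly_ring d). q \<oplus>\<^bsub>mpoly_ring d\<^esub> p = \<zero>\<^bsub>mpoly_ring d\<^esub>"
      by (intro bexI[of _ "- p"]) (simp_all add: mpoly_carrier_uminus)
  qed (simp_all add: mpoly_carrier_0 mpoly_carrier_add ac_simps)
  show "comm_monoid (mpoly_ring d)"
    by (rule comm_monoidI) (simp_all add: mpoly_carrier_1 mpoly_carrier_mult ac_simps)
qed (simp add: algebra_simps)

lemma a_minus_mpoly_ring:
  assumes "p \<in> carrier (mpoly_ring d)" "q \<in> carrier (mpoly_ring d)"
  shows "p \<ominus>\<^bsub>mpoly_ring d\<^esub> q = p - q"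
proof -
  interpret cring "mpoly_ring d" by (rule cring_mpoly_ring)
  have "\<ominus>\<^bsub>mpoly_ring d\<^esub> q = - q"
    by (rule minus_equality) (use assms in \<open>simp_all add: mpoly_carrier_uminus\<close>)
  then show ?thesis by (simp add: a_minus_def)
qed

lemma mpoly_ideal:
  assumes "ideal J (mpoly_ring d)"
  shows mpoly_ideal_carrier: "a \<in> J \<Longrightarrow> a \<in> carrier (mpoly_ring d)"
    and mpoly_ideal_0: "0 \<in> J"
    and mpoly_ideal_add: "\<lbrakk>a \<in> J; b \<in> J\<rbrakk> \<Longrightarrow> a + b \<in> J"
    and mpoly_ideal_mult: "\<lbrakk>a \<in> J; r \<in> carrier (mpoly_ring d)\<rbrakk> \<Longrightarrow> r * a \<in> J"
    and mpoly_ideal_sum: "(\<And>i. i \<in> S \<Longrightarrow> f i \<in> J) \<Longrightarrow> sum f S \<in> J"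
proof -
  interpret ideal J "mpoly_ring d" by fact
  show 0: "0 \<in> J" using additive_subgroup.zero_closed[OF is_additive_subgroup] by simp
  show add: "a + b \<in> J" if "a \<in> J" "b \<in> J" for a b
    using additive_subgroup.a_closed[OF is_additive_subgroup that] by simp
  show "a \<in> J \<Longrightarrow> a \<in> carrier (mpoly_ring d)" by (rule Icarr)
  show "r * a \<in> J" if "a \<in> J" "r \<in> carrier (mpoly_ring d)" for a r
    using I_l_closed[OF that] by simp
  show "sum f S \<in> J" if "\<And>i. i \<in> S \<Longrightarrow> f i \<in> J"
    using that by (induction S rule: infinite_finite_induct) (simp_all add: 0 add)
qed

lemma ideal_mpoly_ringI:
  fixes J :: "'k::field mpoly set"
  assumes "J \<subseteq> carrier (mpoly_ring d)" "0 \<in> J" "\<And>a b. \<lbrakk>a \<in> J; b \<in> J\<rbrakk> \<Longrightarrow> a + b \<in> J"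
    and mult: "\<And>a r. \<lbrakk>a \<in> J; r \<in> carrier (mpoly_ring d)\<rbrakk> \<Longrightarrow> r * a \<in> J"
  shows "ideal J (mpoly_ring d)"
proof -
  interpret cring "mpoly_ring d" by (rule cring_mpoly_ring)
  have "\<ominus>\<^bsub>mpoly_ring d\<^esub> a = - 1 * a" if "a \<in> carrier (mpoly_ring d)" for a :: "'k mpoly"
    by (rule minus_equality) (use that in \<open>simp_all add: mpoly_carrier_uminus\<close>)
  then have inv: "\<ominus>\<^bsub>mpoly_ring d\<^esub> a \<in> J" if "a \<in> J" for a
    using mult[OF that mpoly_carrier_uminus[OF mpoly_carrier_1]] subsetD[OF assms(1) that] by simp
  show ?thesis
  proof (rule idealI)
    show "subgroup J (add_monoid (mpoly_ring d))"
      by (rule add.subgroupI) (use assms inv in \<open>auto simp: a_inv_def\<close>)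
  qed (use assms in \<open>auto simp: ring_axioms mult.commute\<close>)
qed

text \<open>Every monomial of degree \<open>n\<close> is an eigenvector of \<open>\<Sum> x\<^sub>j \<partial>/\<partial>x\<^sub>j\<close> with
  eigenvalue \<open>n\<close>.\<close>

lemma euler_formula:
  assumes "p \<in> carrier (mpoly_ring d)"
  shows "(\<Sum>j\<in>{1..d}. mvar j * partial_deriv j (hom_component n p)) = of_nat n * hom_component n p"
proof (rule poly_mapping_eqI)
  fix m :: "nat \<Rightarrow>\<^sub>0 nat"
  let ?q = "hom_component n p"
  have "Poly_Mapping.lookup (mvar j * partial_deriv j ?q) m =
      of_nat (Poly_Mapping.lookup m j) * Poly_Mapping.lookup ?q m" for j
  proof (cases "Poly_Mapping.lookup m j > 0")
    case True
    have "m - Poly_Mapping.single j 1 + Poly_Mapping.single j 1 = m"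
      using exponent_decompose[OF True] by (simp add: add.commute)
    moreover have "Poly_Mapping.lookup (m - Poly_Mapping.single j 1) j + 1 = Poly_Mapping.lookup m j"
      using True by (simp add: lookup_minus)
    ultimately show ?thesis using True by (simp only: lookup_mvar_times lookup_partial_deriv if_True)
  qed (simp add: lookup_mvar_times)
  then have "Poly_Mapping.lookup (\<Sum>j\<in>{1..d}. mvar j * partial_deriv j ?q) m =
      of_nat (\<Sum>j\<in>{1..d}. Poly_Mapping.lookup m j) * Poly_Mapping.lookup ?q m"
    by (simp add: lookup_sum sum_distrib_right)
  also have "\<dots> = of_nat n * Poly_Mapping.lookup ?q m"
  proof (cases "Poly_Mapping.lookup ?q m = 0")
    case False
    then have "Poly_Mapping.keys m \<subseteq> {1..d}" "monom_deg m = n"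
      using assms by (auto simp: lookup_hom_component carrier_mpoly_ring split: if_splits)
    then show ?thesis using monom_deg_eq[of "{1..d}" m] by simp
  qed simp
  also have "\<dots> = Poly_Mapping.lookup (of_nat n * ?q) m"
    using lookup_single_times[of 0 "of_nat n" ?q m] by simp
  finally show "Poly_Mapping.lookup (\<Sum>j\<in>{1..d}. mvar j * partial_deriv j ?q) m =
      Poly_Mapping.lookup (of_nat n * ?q) m" .
qed

section \<open>The Koszul complex and the formula of Cartan\<close>

text \<open>The sign of moving \<open>dx\<^sub>j\<close> past the factors of \<open>dx\<^sub>A\<close> with a smaller index.\<close>

definition ksign :: "nat \<Rightarrow> nat set \<Rightarrow> 'k::field mpoly"
  where "ksign j A = (- 1) ^ card {a \<in> A. a < j}"

text \<open>A differential form \<open>\<Sum> w(A) dx\<^sub>A\<close> is represented by its coefficient function \<open>w\<close>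
  on finite sets of indices. The Koszul differential is contraction with the Euler vector field
  \<open>\<Sum> x\<^sub>j \<partial>/\<partial>x\<^sub>j\<close>.\<close>

definition contraction :: "nat \<Rightarrow> (nat set \<Rightarrow> 'k::field mpoly) \<Rightarrow> nat set \<Rightarrow> 'k mpoly"
  where "contraction d w A = (\<Sum>j\<in>{1..d} - A. ksign j A * (mvar j * w (insert j A)))"

text \<open>The exterior derivative. Indices outside \<open>{1..d}\<close> are left out of the sum so that a
  function supported on subsets of \<open>{1..d}\<close> is sent to such a function.\<close>

definition ext_deriv :: "nat \<Rightarrow> (nat set \<Rightarrow> 'k::field mpoly) \<Rightarrow> nat set \<Rightarrow> 'k mpoly"
  where "ext_deriv d w A = (\<Sum>j\<in>A \<inter> {1..d}. ksign j (A - {j}) * partial_deriv j (w (A - {j})))"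

lemma ksign_cases: "(ksign j A :: 'k::field mpoly) = 1 \<or> (ksign j A :: 'k mpoly) = - 1"
  unfolding ksign_def by (cases "even (card {a \<in> A. a < j})") auto

lemma ksign_square: "ksign j A * ksign j A = (1 :: 'k::field mpoly)"
  using ksign_cases[of j A, where 'k='k] by auto

text \<open>For \<open>j \<noteq> l\<close> exactly one of \<open>l < j\<close> and \<open>j < l\<close> holds, so exchanging the order in
  which \<open>j\<close> and \<open>l\<close> are inserted changes exactly one sign. Both cancellations in the Koszul
  complex rest on this.\<close>

lemma ksign_insert:
  assumes "finite A" "l \<notin> A"
  shows "ksign j (insert l A) = (if l < j then - ksign j A else ksign j A)"
proof (cases "l < j")
  case True
  then have "{a \<in> insert l A. a < j} = insert l {a \<in> A. a < j}" by auto
  then show ?thesis using assms True by (simp add: ksign_def)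
next
  case False
  then have "{a \<in> insert l A. a < j} = {a \<in> A. a < j}" by auto
  then show ?thesis using False by (simp add: ksign_def)
qed

lemma partial_deriv_ksign:
  fixes p :: "'k::field mpoly"
  shows "partial_deriv l (ksign j A * p) = ksign j A * partial_deriv l p"
  using ksign_cases[of j A, where 'k='k] by (auto simp: partial_deriv_uminus)

lemma hom_component_ksign:
  fixes p :: "'k::field mpoly"
  shows "hom_component n (ksign j A * p) = ksign j A * hom_component n p"
  using ksign_cases[of j A, where 'k='k] by (auto simp: hom_component_uminus)

lemma mpoly_carrier_ksign: "ksign j A \<in> carrier (mpoly_ring d :: 'k::field mpoly ring)"
  using ksign_cases[of j A, where 'k='k] by (auto simp: mpoly_carrier_1 mpoly_carrier_uminus)

text \<open>Cartan's formula \<open>\<iota> d + d \<iota> = L\<close> for the Lie derivative along the Euler field. In both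
  compositions the terms that remove \<open>l\<close> and insert \<open>j \<noteq> l\<close> occur with opposite signs
  (they are called \<open>G j l\<close>). The diagonal terms give \<open>x\<^sub>j \<partial>/\<partial>x\<^sub>j\<close> for every
  \<open>j\<close>, and the product rule contributes one further copy of the coefficient for every element
  of \<open>A\<close>.\<close>

lemma cartan_formula:
  fixes w :: "nat set \<Rightarrow> 'k::field mpoly"
  assumes A: "A \<subseteq> {1..d}"
  shows "contraction d (ext_deriv d w) A + ext_deriv d (contraction d w) A =
    (\<Sum>j\<in>{1..d}. mvar j * partial_deriv j (w A)) + of_nat (card A) * w A"
proof -
  let ?D = "{1..d}"
  have fin: "finite A" using A finite_subset by blast
  define G where "G j l = ksign l (A - {l}) * ksign j (A - {l}) * (mvar j * partial_deriv l (w (insert j (A - {l}))))"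
    for j l
  have 1: "contraction d (ext_deriv d w) A =
      (\<Sum>j\<in>?D - A. mvar j * partial_deriv j (w A)) - (\<Sum>j\<in>?D - A. \<Sum>l\<in>A. G j l)"
  proof -
    have "ksign j A * (mvar j * ext_deriv d w (insert j A)) =
        mvar j * partial_deriv j (w A) - (\<Sum>l\<in>A. G j l)" if j: "j \<in> ?D - A" for j
    proof -
      have "ext_deriv d w (insert j A) = ksign j A * partial_deriv j (w A) +
          (\<Sum>l\<in>A. ksign l (insert j A - {l}) * partial_deriv l (w (insert j A - {l})))"
        unfolding ext_deriv_def using j A fin by (simp add: Int_absorb2 insert_Diff_if)
      also have "(\<Sum>l\<in>A. ksign l (insert j A - {l}) * partial_deriv l (w (insert j A - {l}))) =
          (\<Sum>l\<in>A. ksign l (insert j (A - {l})) * partial_deriv l (w (insert j (A - {l}))))"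
      proof (rule sum.cong[OF refl])
        fix l assume "l \<in> A"
        then have "insert j A - {l} = insert j (A - {l})" using j by auto
        then show "ksign l (insert j A - {l}) * partial_deriv l (w (insert j A - {l})) =
           ksign l (insert j (A - {l})) * partial_deriv l (w (insert j (A - {l})))" by simp
      qed
      finally have "ksign j A * (mvar j * ext_deriv d w (insert j A)) =
          (ksign j A * ksign j A) * (mvar j * partial_deriv j (w A)) + (\<Sum>l\<in>A. (ksign j A *
            ksign l (insert j (A - {l}))) * (mvar j * partial_deriv l (w (insert j (A - {l})))))"
        by (simp add: algebra_simps sum_distrib_left)
      also have "(\<Sum>l\<in>A. (ksign j A *
            ksign l (insert j (A - {l}))) * (mvar j * partial_deriv l (w (insert j (A - {l}))))) = (\<Sum>l\<in>A. - G j l)"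
      proof (rule sum.cong[OF refl])
        fix l assume l: "l \<in> A"
        have "ksign j (insert l B) * ksign l (insert j B) = - (ksign l B * ksign j B :: 'k mpoly)"
          if "finite B" "l \<notin> B" "j \<notin> B" for B
          using that j l by (cases "l < j") (auto simp: ksign_insert)
        from this[of "A - {l}"]
        have "ksign j (insert l (A - {l})) * ksign l (insert j (A - {l})) =
            - (ksign l (A - {l}) * ksign j (A - {l}) :: 'k mpoly)"
          using j fin by blast
        then show "(ksign j A * ksign l (insert j (A - {l}))) *
            (mvar j * partial_deriv l (w (insert j (A - {l})))) = - G j l"
          using l by (simp add: G_def insert_absorb)
      qed
      finally show ?thesis by (simp add: ksign_square sum_negf)
    qed
    then show ?thesis unfolding contraction_def by (simp add: sum_subtractf)
  qed
  have 2: "ext_deriv d (contraction d w) A =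
      (\<Sum>l\<in>A. mvar l * partial_deriv l (w A) + w A) + (\<Sum>l\<in>A. \<Sum>j\<in>?D - A. G j l)"
  proof -
    have "ksign l (A - {l}) * partial_deriv l (contraction d w (A - {l})) =
       (mvar l * partial_deriv l (w A) + w A) + (\<Sum>j\<in>?D - A. G j l)" if l: "l \<in> A" for l
    proof -
      have "?D - (A - {l}) = insert l (?D - A)" using A l by auto
      then have "contraction d w (A - {l}) = ksign l (A - {l}) * (mvar l * w A) +
          (\<Sum>j\<in>?D - A. ksign j (A - {l}) * (mvar j * w (insert j (A - {l}))))"
        unfolding contraction_def using l by (simp add: insert_absorb)
      then have "partial_deriv l (contraction d w (A - {l})) =
          ksign l (A - {l}) * (mvar l * partial_deriv l (w A) + w A) +
          (\<Sum>j\<in>?D - A. ksign j (A - {l}) * (mvar j * partial_deriv l (w (insert j (A - {l})))))"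
        using l by (auto simp: partial_deriv_add partial_deriv_sum partial_deriv_ksign
            partial_deriv_mvar_times intro!: sum.cong)
      then have "ksign l (A - {l}) * partial_deriv l (contraction d w (A - {l})) =
          (ksign l (A - {l}) * ksign l (A - {l})) * (mvar l * partial_deriv l (w A) + w A) +
          (\<Sum>j\<in>?D - A. G j l)"
        by (simp add: distrib_left sum_distrib_left G_def mult.assoc)
      then show ?thesis by (simp add: ksign_square)
    qed
    moreover have "A \<inter> ?D = A" using A by auto
    ultimately show ?thesis unfolding ext_deriv_def by (simp add: sum.distrib)
  qed
  have "(\<Sum>j\<in>?D. mvar j * partial_deriv j (w A)) =
      (\<Sum>j\<in>?D - A. mvar j * partial_deriv j (w A)) + (\<Sum>j\<in>A. mvar j * partial_deriv j (w A))"
    by (rule sum.subset_diff[OF A]) simp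
  moreover have "(\<Sum>j\<in>?D - A. \<Sum>l\<in>A. G j l) = (\<Sum>l\<in>A. \<Sum>j\<in>?D - A. G j l)"
    by (rule sum.swap)
  ultimately show ?thesis unfolding 1 2 by (simp add: sum.distrib)
qed

text \<open>The double sum is antisymmetric in the two inserted indices. It equals its own negative, hence
  vanishes in characteristic zero.\<close>

lemma contraction_contraction:
  fixes w :: "nat set \<Rightarrow> 'k::field_char_0 mpoly"
  assumes A: "A \<subseteq> {1..d}"
  shows "contraction d (contraction d w) A = 0"
proof -
  let ?E = "{1..d} - A"
  have fin: "finite A" using A finite_subset by blast
  define F where "F j l = (if j = l then 0 else
      ksign j A * ksign l (insert j A) * (mvar j * mvar l * w (insert l (insert j A))))" for j l
  have F: "F l j = - F j l" if "j \<in> ?E" "l \<in> ?E" for j l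
  proof (cases "j = l")
    case False
    then have "ksign l A * ksign j (insert l A) = - (ksign j A * ksign l (insert j A) :: 'k mpoly)"
      using that fin by (cases "l < j") (auto simp: ksign_insert)
    then show ?thesis using False by (simp add: F_def insert_commute mult.commute)
  qed (simp add: F_def)
  have eq: "contraction d (contraction d w) A = (\<Sum>j\<in>?E. \<Sum>l\<in>?E. F j l)"
    unfolding contraction_def[of d "contraction d w"]
  proof (rule sum.cong[OF refl])
    fix j assume j: "j \<in> ?E"
    have "(\<Sum>l\<in>?E. F j l) = (\<Sum>l\<in>{1..d} - insert j A. F j l)"
      by (rule sum.mono_neutral_right) (auto simp: F_def)
    then show "ksign j A * (mvar j * contraction d w (insert j A)) = (\<Sum>l\<in>?E. F j l)"
      by (auto simp: contraction_def F_def sum_distrib_left mult_ac intro!: sum.cong)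
  qed
  have "(\<Sum>j\<in>?E. \<Sum>l\<in>?E. F j l) = (\<Sum>l\<in>?E. \<Sum>j\<in>?E. F j l)" by (rule sum.swap)
  also have "\<dots> = (\<Sum>l\<in>?E. \<Sum>j\<in>?E. - F l j)"
    by (intro sum.cong refl F)
  also have "\<dots> = - (\<Sum>j\<in>?E. \<Sum>l\<in>?E. F j l)"
    by (simp only: sum_negf)
  finally have "2 * (\<Sum>j\<in>?E. \<Sum>l\<in>?E. F j l) = 0" by (simp add: eq_neg_iff_add_eq_0)
  then show ?thesis by (simp add: eq)
qed

lemma hom_component_contraction:
  "contraction d (\<lambda>A. hom_component e (w A)) A = hom_component (Suc e) (contraction d w A)"
  by (simp add: contraction_def hom_component_sum hom_component_ksign hom_component_Suc_mvar_times)

text \<open>A module record extends a ring record, but forms of a fixed degree have no product and no unit;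
  hence the two undefined fields.\<close>

definition koszul_module :: "nat \<Rightarrow> nat \<Rightarrow> ('k::field mpoly, nat set \<Rightarrow> 'k mpoly) module"
  where "koszul_module d n =
    \<lparr>carrier = {w. \<forall>A. w A \<in> carrier (mpoly_ring d) \<and> (w A \<noteq> 0 \<longrightarrow> A \<subseteq> {1..d} \<and> card A = n)},
     monoid.mult = undefined, one = undefined, ring.zero = (\<lambda>_. 0), ring.add = (\<lambda>v w A. v A + w A),
     smult = (\<lambda>r w A. r * w A)\<rparr>"

lemma koszul_simps [simp]:
  "\<zero>\<^bsub>koszul_module d n\<^esub> = (\<lambda>_. 0)" "v \<oplus>\<^bsub>koszul_module d n\<^esub> w = (\<lambda>A. v A + w A)"
  "r \<odot>\<^bsub>koszul_module d n\<^esub> w = (\<lambda>A. r * w A)"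
  by (simp_all add: koszul_module_def)

lemma koszul_carrier:
  "w \<in> carrier (koszul_module d n) \<longleftrightarrow>
    (\<forall>A. w A \<in> carrier (mpoly_ring d)) \<and> (\<forall>A. \<not> (A \<subseteq> {1..d} \<and> card A = n) \<longrightarrow> w A = 0)"
  by (auto simp: koszul_module_def)

lemma koszul_carrierD:
  "w \<in> carrier (koszul_module d n) \<Longrightarrow> w A \<in> carrier (mpoly_ring d)"
  "\<lbrakk>w \<in> carrier (koszul_module d n); \<not> (A \<subseteq> {1..d} \<and> card A = n)\<rbrakk> \<Longrightarrow> w A = 0"
  by (auto simp: koszul_carrier)

lemma koszul_closed:
  "(\<lambda>_. 0) \<in> carrier (koszul_module d n)"
  "\<lbrakk>v \<in> carrier (koszul_module d n); w \<in> carrier (koszul_module d n)\<rbrakk> \<Longrightarrow> (\<lambda>A. v A + w A) \<in> carrier (koszul_module d n)"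
  "w \<in> carrier (koszul_module d n) \<Longrightarrow> (\<lambda>A. - w A) \<in> carrier (koszul_module d n)"
  "\<lbrakk>r \<in> carrier (mpoly_ring d); w \<in> carrier (koszul_module d n)\<rbrakk> \<Longrightarrow> (\<lambda>A. r * w A) \<in> carrier (koszul_module d n)"
  by (auto simp: koszul_carrier mpoly_carrier_0 mpoly_carrier_add mpoly_carrier_uminus mpoly_carrier_mult)

lemma module_koszul: "module (mpoly_ring d) (koszul_module d n)"
proof (rule moduleI)
  show "abelian_group (koszul_module d n)"
  proof (rule abelian_groupI)
    fix w assume "w \<in> carrier (koszul_module d n)"
    then show "\<exists>v\<in>carrier (koszul_module d n). v \<oplus>\<^bsub>koszul_module d n\<^esub> w = \<zero>\<^bsub>koszul_module d n\<^esub>"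
      by (intro bexI[of _ "\<lambda>A. - w A"]) (simp_all add: koszul_closed)
  qed (simp_all add: koszul_closed ac_simps)
qed (simp_all add: koszul_closed cring_mpoly_ring algebra_simps)

lemma a_minus_koszul:
  assumes "w \<in> carrier (koszul_module d n)"
  shows "v \<ominus>\<^bsub>koszul_module d n\<^esub> w = (\<lambda>A. v A - w A)"
proof -
  interpret module "mpoly_ring d" "koszul_module d n" by (rule module_koszul)
  have "\<ominus>\<^bsub>koszul_module d n\<^esub> w = (\<lambda>A. - w A)"
    by (rule M.minus_equality) (use assms in \<open>simp_all add: koszul_closed\<close>)
  then show ?thesis by (simp add: a_minus_def)
qed

definition koszul_basis :: "nat \<Rightarrow> nat \<Rightarrow> nat set \<Rightarrow> nat set \<Rightarrow> 'k::field mpoly"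
  where "koszul_basis d n A B = (if B = A \<and> A \<subseteq> {1..d} \<and> card A = n then 1 else 0)"

lemma dual_basis_koszul:
  "dual_basis (mpoly_ring d :: 'k::field mpoly ring) (koszul_module d n) (koszul_basis d n) (\<lambda>A w. w A)"
proof -
  interpret module "mpoly_ring d" "koszul_module d n" by (rule module_koszul)
  have e: "(koszul_basis d n A :: nat set \<Rightarrow> 'k mpoly) \<in> carrier (koszul_module d n)" for A
    by (auto simp: koszul_carrier koszul_basis_def mpoly_carrier_0 mpoly_carrier_1)
  have fin: "finite {A. w A \<noteq> 0}" if "w \<in> carrier (koszul_module d n)" for w :: "nat set \<Rightarrow> 'k mpoly"
    by (rule finite_subset[of _ "Pow {1..d}"]) (use koszul_carrierD(2)[OF that] in auto)
  have finsum: "finsum (koszul_module d n) f S B = (\<Sum>A\<in>S. f A B)"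
    if "finite S" "\<And>A. f A \<in> carrier (koszul_module d n)" for f :: "nat set \<Rightarrow> nat set \<Rightarrow> 'k mpoly" and S B
    using that(1) by (induction S) (simp_all add: that(2) Pi_iff)
  have "lincomb (koszul_module d n) w (koszul_basis d n) = w" if w: "w \<in> carrier (koszul_module d n)"
    for w :: "nat set \<Rightarrow> 'k mpoly"
  proof
    fix B
    have "lincomb (koszul_module d n) w (koszul_basis d n) B =
        (\<Oplus>\<^bsub>koszul_module d n\<^esub> A\<in>Pow {1..d}. w A \<odot>\<^bsub>koszul_module d n\<^esub> koszul_basis d n A) B"
      by (subst lincomb_eq_finsum[of "Pow {1..d}"]) (use w e koszul_carrierD[OF w] in auto)
    also have "\<dots> = (\<Sum>A\<in>Pow {1..d}. w A * koszul_basis d n A B)"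
      by (subst finsum) (use koszul_closed(4)[OF koszul_carrierD(1)[OF w] e] in auto)
    also have "\<dots> = (\<Sum>A\<in>Pow {1..d}. if A = B then w B else 0)"
      by (rule sum.cong) (use koszul_carrierD(2)[OF w] in \<open>auto simp: koszul_basis_def\<close>)
    also have "\<dots> = w B" using koszul_carrierD(2)[OF w, of B] by auto
    finally show "lincomb (koszul_module d n) w (koszul_basis d n) B = w B" .
  qed
  then show ?thesis
    unfolding dual_basis_def using e fin by (simp add: koszul_carrierD)
qed

lemma contraction_koszul_hom:
  "contraction d \<in> module_hom (mpoly_ring d) (koszul_module d (Suc n)) (koszul_module d n)"
proof (rule module_homI)
  fix w assume w: "w \<in> carrier (koszul_module d (Suc n))"
  have "contraction d w A = 0" if "\<not> (A \<subseteq> {1..d} \<and> card A = n)" for A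
  proof -
    have "w (insert j A) = 0" if j: "j \<in> {1..d} - A" for j
    proof (rule koszul_carrierD(2)[OF w])
      have "finite A" if "A \<subseteq> {1..d}" using that finite_subset by blast
      then show "\<not> (insert j A \<subseteq> {1..d} \<and> card (insert j A) = Suc n)"
        using \<open>\<not> (A \<subseteq> {1..d} \<and> card A = n)\<close> j by auto
    qed
    then show ?thesis by (simp add: contraction_def)
  qed
  then show "contraction d w \<in> carrier (koszul_module d n)"
    using koszul_carrierD(1)[OF w]
    by (auto simp: koszul_carrier contraction_def intro!: mpoly_carrier_sum mpoly_carrier_mult
        mpoly_carrier_ksign mpoly_carrier_mvar)
qed (auto simp: contraction_def algebra_simps sum.distrib sum_distrib_left)

lemma ext_deriv_koszul_closed:
  assumes w: "w \<in> carrier (koszul_module d n)"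
  shows "ext_deriv d w \<in> carrier (koszul_module d (Suc n))"
proof -
  have "ext_deriv d w A = 0" if "\<not> (A \<subseteq> {1..d} \<and> card A = Suc n)" for A
  proof -
    have "w (A - {j}) = 0" if j: "j \<in> A \<inter> {1..d}" for j
    proof (rule koszul_carrierD(2)[OF w])
      have "A \<subseteq> {1..d} \<and> card A = Suc n" if a: "A - {j} \<subseteq> {1..d}" "card (A - {j}) = n"
      proof -
        have "finite (A - {j})" using a(1) finite_subset by blast
        then have "card A = Suc n" using a(2) j card.remove[of A j] by simp
        then show ?thesis using a(1) j by auto
      qed
      then show "\<not> (A - {j} \<subseteq> {1..d} \<and> card (A - {j}) = n)"
        using \<open>\<not> (A \<subseteq> {1..d} \<and> card A = Suc n)\<close> by blast
    qed
    then show ?thesis by (simp add: ext_deriv_def)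
  qed
  then show ?thesis
    using koszul_carrierD(1)[OF w]
    by (auto simp: koszul_carrier ext_deriv_def intro!: mpoly_carrier_sum mpoly_carrier_mult
        mpoly_carrier_ksign mpoly_carrier_partial_deriv)
qed

lemma contraction_sum: "contraction d (\<lambda>A. \<Sum>i\<in>S. f i A) B = (\<Sum>i\<in>S. contraction d (f i) B)"
  unfolding contraction_def by (subst sum.swap) (simp add: sum_distrib_left)

lemma contraction_scale: "contraction d (\<lambda>A. c * w A) B = c * contraction d w B"
  unfolding contraction_def by (simp add: sum_distrib_left mult_ac)

text \<open>Let \<open>u\<close> be the part of \<open>w\<close> with coefficients of degree
  \<open>e\<close>. Cartan's formula and Euler's formula give \<open>(e + n) u = \<iota> d u + d \<iota> u\<close>. Since
  \<open>I\<close> is graded, \<open>\<iota> u\<close> has coefficients in \<open>I\<close>, so \<open>d \<iota> u\<close> has coefficients in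
  \<open>J\<close>, and \<open>u\<close> is \<open>\<iota>\<close> of \<open>d u / (e + n)\<close> modulo \<open>J\<close>. The division needs
  characteristic zero and \<open>e + n > 0\<close>; for \<open>n = 0\<close> the constant part must vanish.
  With \<open>I = J = 0\<close> the lemma is the exactness of the Koszul complex.\<close>

lemma koszul_relative_boundary:
  fixes w :: "nat set \<Rightarrow> 'k::field_char_0 mpoly"
  assumes I: "\<And>f e. f \<in> I \<Longrightarrow> hom_component e f \<in> I"
    and J: "ideal J (mpoly_ring d)"
    and IJ: "\<And>f j. \<lbrakk>f \<in> I; j \<in> {1..d}\<rbrakk> \<Longrightarrow> partial_deriv j f \<in> J"
    and w: "w \<in> carrier (koszul_module d n)" and wI: "\<And>A. contraction d w A \<in> I"
    and pos: "n = 0 \<Longrightarrow> hom_component 0 (w {}) = 0"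
  obtains v where "v \<in> carrier (koszul_module d (Suc n))" "\<And>A. w A - contraction d v A \<in> J"
proof -
  have comp: "\<exists>v\<in>carrier (koszul_module d (Suc n)). \<forall>A. hom_component e (w A) - contraction d v A \<in> J" for e
  proof -
    define u where "u A = hom_component e (w A)" for A
    \<comment> \<open>For \<open>e + n = 0\<close> this is \<open>0\<close>, which is harmless because \<open>u\<close> vanishes in that case.\<close>
    define c where "c = (Poly_Mapping.single 0 (inverse (of_nat (e + n))) :: 'k mpoly)"
    have c: "c \<in> carrier (mpoly_ring d)" unfolding c_def by (rule mpoly_carrier_single) simp
    have u: "u \<in> carrier (koszul_module d n)"
      using w by (simp add: koszul_carrier u_def mpoly_carrier_hom_component)
    have du: "ext_deriv d u \<in> carrier (koszul_module d (Suc n))" by (rule ext_deriv_koszul_closed[OF u])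
    have scale: "c * (of_nat (e + n) * u A) = u A" for A
    proof (cases "e + n = 0")
      case True
      then have "u A = 0"
        using pos koszul_carrierD(2)[OF u, of A] finite_subset[of A "{1..d}"]
        by (cases "A \<subseteq> {1..d} \<and> card A = n") (auto simp: u_def)
      then show ?thesis by simp
    next
      case False
      then have "(of_nat (e + n) :: 'k) \<noteq> 0" unfolding of_nat_eq_0_iff .
      then have "c * of_nat (e + n) = 1"
        unfolding c_def single_of_nat[symmetric] mult_single by (simp del: of_nat_add)
      then show ?thesis by (simp add: mult.assoc[symmetric])
    qed
    have "u A - contraction d (\<lambda>A. c * ext_deriv d u A) A \<in> J" for A
    proof (cases "A \<subseteq> {1..d}")
      case True
      have "(\<Sum>j\<in>{1..d}. mvar j * partial_deriv j (u A)) = of_nat e * u A"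
        unfolding u_def by (rule euler_formula[OF koszul_carrierD(1)[OF w]])
      moreover have "of_nat (card A) * u A = of_nat n * u A"
        using koszul_carrierD(2)[OF u, of A] True by (cases "card A = n") auto
      ultimately have "contraction d (ext_deriv d u) A + ext_deriv d (contraction d u) A = of_nat (e + n) * u A"
        using cartan_formula[OF True, of u] by (simp add: algebra_simps)
      then have "c * contraction d (ext_deriv d u) A + c * ext_deriv d (contraction d u) A = u A"
        using scale[of A] by (simp add: distrib_left[symmetric])
      then have "u A - contraction d (\<lambda>A. c * ext_deriv d u A) A = c * ext_deriv d (contraction d u) A"
        by (simp add: contraction_scale algebra_simps)
      also have "\<dots> \<in> J"
      proof -
        have "contraction d u B \<in> I" for B
          unfolding u_def hom_component_contraction by (rule I[OF wI])
        then show ?thesis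
          unfolding ext_deriv_def
          by (intro mpoly_ideal_mult[OF J _ c] mpoly_ideal_sum[OF J] mpoly_ideal_mult[OF J _ mpoly_carrier_ksign] IJ) auto
      qed
      finally show ?thesis .
    next
      case False
      have "contraction d (ext_deriv d u) A = 0"
        using koszul_carrierD(2)[OF module_hom_closed[OF contraction_koszul_hom du]] False by blast
      then show ?thesis
        using koszul_carrierD(2)[OF u, of A] False mpoly_ideal_0[OF J] by (simp add: contraction_scale)
    qed
    moreover have "(\<lambda>A. c * ext_deriv d u A) \<in> carrier (koszul_module d (Suc n))"
      by (rule koszul_closed(4)[OF c du])
    ultimately show ?thesis unfolding u_def by blast
  qed
  then obtain v where v: "\<And>e. v e \<in> carrier (koszul_module d (Suc n))"
    "\<And>e A. hom_component e (w A) - contraction d (v e) A \<in> J" by metis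
  define E where "E = (\<Union>A\<in>Pow {1..d}. monom_deg ` Poly_Mapping.keys (w A))"
  have E: "finite E" by (simp add: E_def)
  have wE: "(\<Sum>e\<in>E. hom_component e (w A)) = w A" for A
  proof (rule sum_hom_component[OF E])
    show "monom_deg ` Poly_Mapping.keys (w A) \<subseteq> E"
      using koszul_carrierD(2)[OF w, of A] by (cases "A \<subseteq> {1..d}") (auto simp: E_def)
  qed
  show thesis
  proof
    have "(\<lambda>A. \<Sum>e\<in>S. v e A) \<in> carrier (koszul_module d (Suc n))" for S
      by (induction S rule: infinite_finite_induct) (simp_all add: koszul_closed v)
    then show "(\<lambda>A. \<Sum>e\<in>E. v e A) \<in> carrier (koszul_module d (Suc n))" .
    fix A
    have "w A - contraction d (\<lambda>A. \<Sum>e\<in>E. v e A) A = (\<Sum>e\<in>E. hom_component e (w A) - contraction d (v e) A)"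
      by (simp add: contraction_sum sum_subtractf wE)
    then show "w A - contraction d (\<lambda>A. \<Sum>e\<in>E. v e A) A \<in> J"
      using mpoly_ideal_sum[OF J v(2)] by simp
  qed
qed

section \<open>The Koszul complex resolves the residue field\<close>

text \<open>The polynomials without constant term form an ideal that contains the variables, hence contains
  the ideal generated by them. This gives the exactness of the augmented Koszul complex in degree
  zero.\<close>

lemma irrelevant_ideal:
  fixes d :: nat
  defines "\<mm> \<equiv> Idl\<^bsub>mpoly_ring d\<^esub> (mvar ` {1..d}) :: 'k::field mpoly set"
  shows ideal_irrelevant: "ideal \<mm> (mpoly_ring d)"
    and mvar_irrelevant: "j \<in> {1..d} \<Longrightarrow> mvar j \<in> \<mm>"
    and hom_component_0_irrelevant: "a \<in> \<mm> \<Longrightarrow> hom_component 0 a = 0"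
proof -
  interpret cring "mpoly_ring d :: 'k mpoly ring" by (rule cring_mpoly_ring)
  have sub: "mvar ` {1..d} \<subseteq> (carrier (mpoly_ring d) :: 'k mpoly set)"
    using mpoly_carrier_mvar by blast
  show "ideal \<mm> (mpoly_ring d)" unfolding \<mm>_def by (rule genideal_ideal[OF sub])
  show "mvar j \<in> \<mm>" if "j \<in> {1..d}" using genideal_self[OF sub] that by (auto simp: \<mm>_def)
  let ?Z = "{a \<in> carrier (mpoly_ring d). Poly_Mapping.lookup a 0 = 0} :: 'k mpoly set"
  have mult: "Poly_Mapping.lookup (r * a) 0 = 0" if "Poly_Mapping.lookup a 0 = 0" for r a :: "'k mpoly"
  proof (induction r rule: mpoly_induct)
    case (single m c)
    show ?case
    proof (cases "m = 0")
      case True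
      then show ?thesis using lookup_single_times[of 0 c a 0] that by simp
    next
      case False
      have "m + m' \<noteq> 0" for m' using False by (metis add_eq_0_iff_both_eq_0 monom_deg_add monom_deg_eq_0_iff)
      then show ?thesis by (metis lookup_single_times_eq_0)
    qed
  qed (simp_all add: lookup_add distrib_right)
  have "ideal ?Z (mpoly_ring d)"
    by (rule ideal_mpoly_ringI)
       (use mult in \<open>auto simp: mpoly_carrier_0 mpoly_carrier_add mpoly_carrier_mult lookup_add\<close>)
  moreover have "mvar ` {1..d} \<subseteq> ?Z"
    using sub by (auto simp: mvar_def lookup_single when_def poly_mapping_eq_iff[of "Poly_Mapping.single _ _" 0] fun_eq_iff)
  ultimately have "\<mm> \<subseteq> ?Z" unfolding \<mm>_def by (rule genideal_minimal)
  then show "hom_component 0 a = 0" if "a \<in> \<mm>"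
    using that by (intro poly_mapping_eqI) (auto simp: lookup_hom_component monom_deg_eq_0_iff)
qed

lemma module_residue: "module (mpoly_ring d) (residue_module d)"
  unfolding residue_module_def by (rule quot_module_module[OF cring_mpoly_ring ideal_irrelevant])

lemma koszul_exact:
  fixes w :: "nat set \<Rightarrow> 'k::field_char_0 mpoly"
  assumes "w \<in> carrier (koszul_module d n)" "\<And>A. contraction d w A = 0"
    and "n = 0 \<Longrightarrow> hom_component 0 (w {}) = 0"
  shows "w \<in> contraction d ` carrier (koszul_module d (Suc n))"
proof -
  have zero: "ideal {0} (mpoly_ring d :: 'k mpoly ring)"
    by (rule ideal_mpoly_ringI) (auto simp: mpoly_carrier_0)
  obtain v where "v \<in> carrier (koszul_module d (Suc n))" "\<And>A. w A - contraction d v A \<in> {0}"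
    by (rule koszul_relative_boundary[of "{0}" "{0}" d w n]) (use assms zero in auto)
  then show ?thesis by (intro image_eqI[of _ _ v]) auto
qed

lemma koszul_resolution:
  "resolution (mpoly_ring d) (residue_module d :: ('k::field_char_0 mpoly, _) module) (koszul_module d) (\<lambda>_. contraction d)
    (\<lambda>w. Idl\<^bsub>mpoly_ring d\<^esub> (mvar ` {1..d}) +>\<^bsub>mpoly_ring d\<^esub> w {})"
  (is "resolution ?S ?k _ _ _")
proof -
  define m :: "'k mpoly set" where "m = Idl\<^bsub>mpoly_ring d\<^esub> (mvar ` {1..d})"
  have m: "ideal m ?S" and mvar_m: "\<And>j. j \<in> {1..d} \<Longrightarrow> mvar j \<in> m"
    and comp_m: "\<And>a. a \<in> m \<Longrightarrow> hom_component 0 a = 0"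
    unfolding m_def by (rule ideal_irrelevant mvar_irrelevant hom_component_0_irrelevant; assumption?)+
  interpret m: ideal m ?S by (rule m)
  interpret k: module ?S ?k by (rule module_residue)
  have k: "?k = quot_module ?S m" by (simp add: residue_module_def m_def)
  have zero: "m +>\<^bsub>?S\<^esub> a = \<zero>\<^bsub>?k\<^esub> \<longleftrightarrow> a \<in> m" if "a \<in> carrier ?S" for a
    unfolding k m.quot_module_zero
    using m.quotient_eq_iff_same_a_r_cos[OF m that, of 0] that
    by (simp add: mpoly_carrier_0 a_minus_mpoly_ring)
  show ?thesis
    unfolding m_def[symmetric]
  proof (rule resolution.intro[OF module_residue resolution_axioms.intro], goal_cases)
    case (1 n)
    show ?case by (rule module_koszul)
  next
    case (2 n)
    show ?case by (rule contraction_koszul_hom)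
  next
    case 3
    show ?case
      by (rule module_homI)
         (auto simp: k m.carrier_quot_module m.quot_module_add m.quot_module_smult koszul_carrierD)
  next
    case (4 y)
    then obtain a where a: "a \<in> carrier ?S" "y = m +>\<^bsub>?S\<^esub> a" by (auto simp: k m.carrier_quot_module)
    then have "(\<lambda>A. if A = {} then a else 0) \<in> carrier (koszul_module d 0)"
      by (auto simp: koszul_carrier mpoly_carrier_0)
    then show ?case using a(2) by (intro image_eqI) auto
  next
    case (5 w)
    have "ksign j {} * (mvar j * w {j}) \<in> m" if j: "j \<in> {1..d}" for j
    proof -
      have "mvar j * w {j} \<in> m"
        using mpoly_ideal_mult[OF m mvar_m[OF j] koszul_carrierD(1)[OF 5, of "{j}"]]
        by (simp add: mult.commute)
      then show ?thesis by (rule mpoly_ideal_mult[OF m _ mpoly_carrier_ksign])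
    qed
    then have "contraction d w {} \<in> m" unfolding contraction_def
      by (intro mpoly_ideal_sum[OF m]) simp
    then show ?case using zero m.Icarr by blast
  next
    case (6 w)
    have "w {} \<in> m" using zero[OF koszul_carrierD(1)[OF 6(1)]] 6(2) by blast
    then have "hom_component 0 (w {}) = 0" by (rule comp_m)
    moreover have "contraction d w A = 0" for A
      unfolding contraction_def
    proof (rule sum.neutral, rule ballI)
      fix j assume "j \<in> {1..d} - A"
      have "\<not> (insert j A \<subseteq> {1..d} \<and> card (insert j A) = 0)"
        by (auto simp: card_eq_0_iff finite_subset[of _ "{1..d}"])
      then have "w (insert j A) = 0" by (rule koszul_carrierD(2)[OF 6(1)])
      then show "ksign j A * (mvar j * w (insert j A)) = 0" by simp
    qed
    ultimately show ?case using koszul_exact[OF 6(1)] by simp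
  next
    case (7 w n)
    have "contraction d (contraction d w) A = 0" for A
    proof (cases "A \<subseteq> {1..d}")
      case False
      then show ?thesis
        using koszul_carrierD(2)[OF module_hom_closed[OF contraction_koszul_hom
          module_hom_closed[OF contraction_koszul_hom 7]]] by blast
    qed (rule contraction_contraction)
    then show ?case by auto
  next
    case (8 w n)
    then show ?case by (intro koszul_exact) (auto simp: fun_eq_iff)
  qed
qed

section \<open>Vanishing of the map on Tor\<close>

lemma ideal_smult_koszul:
  assumes I: "ideal I (mpoly_ring d)" and "w \<in> ideal_smult I (koszul_module d n)"
  shows "w A \<in> I"
  using assms(2)
proof (induction rule: ideal_smult.induct)
  case (smult a x)
  then show ?case
    using mpoly_ideal_mult[OF I smult(1) koszul_carrierD(1)[OF smult(2), of A]] by (simp add: mult.commute)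
qed (simp add: mpoly_ideal_add[OF I])

text \<open>For the Koszul resolution \<open>koszul_relative_boundary\<close> says that chains with boundary in
  \<open>I\<close> are boundaries modulo \<open>J\<close>; \<open>relative_boundary_transfer\<close> carries this over to the
  given resolution, and \<open>Tor_map_zero\<close> translates it into Tor.\<close>

lemma Tor_surj_zero_if_deriv:
  fixes P :: "nat \<Rightarrow> (('k::field_char_0) mpoly, 'c) module"
  assumes res: "free_resolution (mpoly_ring d) (residue_module d) P \<delta> \<epsilon>"
    and I: "graded_ideal d I" and J: "ideal J (mpoly_ring d)" and sub: "I \<subseteq> J" and deriv: "deriv_ideal d I \<subseteq> J"
  shows "Tor_surj_zero d P \<delta> I J (Suc n)"
proof -
  interpret P: resolution "mpoly_ring d" "residue_module d" P \<delta> \<epsilon>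
    by (rule free_resolution_resolution[OF module_residue res])
  have "\<exists>e :: 'c \<Rightarrow> 'c. \<exists>c. dual_basis (mpoly_ring d) (P m) e c" for m
    using res free_module_dual_basis unfolding free_resolution_def by metis
  then obtain e :: "nat \<Rightarrow> 'c \<Rightarrow> 'c" and c where basis: "\<And>m. dual_basis (mpoly_ring d) (P m) (e m) (c m)"
    by metis
  have idI: "ideal I (mpoly_ring d)" using I by (simp add: graded_ideal_def)
  have deriv: "partial_deriv j f \<in> J" if "f \<in> I" "j \<in> {1..d}" for f j
  proof -
    have "partial_deriv j f \<in> deriv_ideal d I"
      unfolding deriv_ideal_def genideal_def using that by blast
    then show ?thesis using deriv by blast
  qed
  have koszul: "\<exists>v\<in>carrier (koszul_module d (Suc (Suc n))).
      w \<ominus>\<^bsub>koszul_module d (Suc n)\<^esub> contraction d v \<in> ideal_smult J (koszul_module d (Suc n))"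
    if w: "w \<in> carrier (koszul_module d (Suc n))" and wI: "contraction d w \<in> ideal_smult I (koszul_module d n)" for w
  proof -
    interpret Kn: module "mpoly_ring d" "koszul_module d (Suc n)" by (rule module_koszul)
    obtain v where v: "v \<in> carrier (koszul_module d (Suc (Suc n)))" "\<And>A. w A - contraction d v A \<in> J"
      by (rule koszul_relative_boundary[OF _ J deriv w])
         (use I ideal_smult_koszul[OF idI wI] in \<open>auto simp: graded_ideal_def\<close>)
    have cv: "contraction d v \<in> carrier (koszul_module d (Suc n))"
      by (rule module_hom_closed[OF contraction_koszul_hom v(1)])
    have "w \<ominus>\<^bsub>koszul_module d (Suc n)\<^esub> contraction d v \<in> ideal_smult J (koszul_module d (Suc n))"
      by (rule dual_basis_ideal_smultI[OF module_koszul J dual_basis_koszul])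
         (use v(2) Kn.M.minus_closed[OF w cv] in \<open>simp_all add: a_minus_koszul[OF cv]\<close>)
    then show ?thesis using v(1) by blast
  qed
  show ?thesis
    unfolding Tor_surj_zero_def
  proof (rule Tor_map_zero[where P = P and \<delta> = \<delta> and n = n, OF cring_mpoly_ring idI J sub P.module P.\<delta>_hom])
    show "\<delta> n (\<delta> (Suc n) x) = \<zero>\<^bsub>P n\<^esub>" if "x \<in> carrier (P (Suc (Suc n)))" for x
      by (rule P.\<delta>_\<delta>[OF that])
    fix p assume "p \<in> carrier (P (Suc n))" "\<delta> n p \<in> ideal_smult I (P n)"
    then show "\<exists>q\<in>carrier (P (Suc (Suc n))). p \<ominus>\<^bsub>P (Suc n)\<^esub> \<delta> (Suc n) q \<in> ideal_smult J (P (Suc n))"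
      using relative_boundary_transfer[where n = n, OF P.resolution_axioms koszul_resolution basis
          dual_basis_koszul idI J sub koszul] by simp
  qed
qed

section \<open>Powers of a graded ideal\<close>

lemma hom_component_mult_homogeneous:
  "hom_component n (hom_component a p * hom_component b q) =
    (if a + b = n then hom_component a p * hom_component b q else 0)"
proof -
  let ?r = "hom_component a p * hom_component b q"
  have "monom_deg m = a + b" if m: "Poly_Mapping.lookup ?r m \<noteq> 0" for m
  proof -
    have "m \<in> Poly_Mapping.keys ?r" using m by (simp add: in_keys_iff)
    then obtain s t where st: "m = s + t" "s \<in> Poly_Mapping.keys (hom_component a p)"
      "t \<in> Poly_Mapping.keys (hom_component b q)"
      using subsetD[OF keys_mult] by blast
    then have "monom_deg s = a" "monom_deg t = b"
      by (auto simp: in_keys_iff lookup_hom_component split: if_splits)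
    then show ?thesis using st(1) by (simp add: monom_deg_add)
  qed
  then have "Poly_Mapping.lookup ?r m = 0" if "monom_deg m \<noteq> a + b" for m
    using that by blast
  then show ?thesis by (intro poly_mapping_eqI) (simp add: lookup_hom_component)
qed

text \<open>A product of two elements is the sum of the products of their homogeneous components, and each
  of these products is homogeneous and lies in the product of the ideals.\<close>

lemma graded_ideal_prod:
  assumes I: "graded_ideal d I" and J: "graded_ideal d J"
  shows "graded_ideal d (I \<cdot>\<^bsub>mpoly_ring d\<^esub> J)"
proof -
  interpret cring "mpoly_ring d" by (rule cring_mpoly_ring)
  have id: "ideal (I \<cdot>\<^bsub>mpoly_ring d\<^esub> J) (mpoly_ring d)"
    using I J by (simp add: graded_ideal_def ideal_prod_is_ideal)
  have "hom_component n f \<in> I \<cdot>\<^bsub>mpoly_ring d\<^esub> J" if "f \<in> I \<cdot>\<^bsub>mpoly_ring d\<^esub> J" for f n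
    using that
  proof (induction rule: ideal_prod.induct)
    case (prod p q)
    let ?A = "monom_deg ` Poly_Mapping.keys p" and ?B = "monom_deg ` Poly_Mapping.keys q"
    have "p * q = (\<Sum>a\<in>?A. \<Sum>b\<in>?B. hom_component a p * hom_component b q)"
      using sum_hom_component[of ?A p] sum_hom_component[of ?B q] by (simp add: sum_product[symmetric])
    then have "hom_component n (p * q) =
        (\<Sum>a\<in>?A. \<Sum>b\<in>?B. hom_component n (hom_component a p * hom_component b q))"
      by (simp add: hom_component_sum)
    also have "\<dots> \<in> I \<cdot>\<^bsub>mpoly_ring d\<^esub> J"
    proof (intro mpoly_ideal_sum[OF id])
      fix a b
      have "hom_component a p * hom_component b q \<in> I \<cdot>\<^bsub>mpoly_ring d\<^esub> J"
        using ideal_prod.prod[of "hom_component a p" I "hom_component b q" J "mpoly_ring d"] I J prod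
        by (simp add: graded_ideal_def)
      then show "hom_component n (hom_component a p * hom_component b q) \<in> I \<cdot>\<^bsub>mpoly_ring d\<^esub> J"
        by (simp add: hom_component_mult_homogeneous mpoly_ideal_0[OF id])
    qed
    finally show ?case by simp
  next
    case (sum f g)
    then show ?case by (simp add: hom_component_add mpoly_ideal_add[OF id])
  qed
  then show ?thesis using id by (simp add: graded_ideal_def)
qed

lemma ideal_pow_simps:
  "\<one>\<^bsub>ideals_set R\<^esub> = carrier R"
  "I \<otimes>\<^bsub>ideals_set R\<^esub> J = I \<cdot>\<^bsub>R\<^esub> J"
  "I [^]\<^bsub>ideals_set R\<^esub> (0::nat) = carrier R"
  "I [^]\<^bsub>ideals_set R\<^esub> Suc n = (I [^]\<^bsub>ideals_set R\<^esub> n) \<cdot>\<^bsub>R\<^esub> I"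
  by (simp_all add: nat_pow_def ideals_set_def)

lemma graded_ideal_pow:
  assumes "graded_ideal d I"
  shows "graded_ideal d (I [^]\<^bsub>ideals_set (mpoly_ring d)\<^esub> (n::nat))"
proof (induction n)
  case 0
  interpret cring "mpoly_ring d" by (rule cring_mpoly_ring)
  show ?case by (simp add: ideal_pow_simps graded_ideal_def oneideal mpoly_carrier_hom_component)
next
  case (Suc n)
  then show ?case by (simp add: ideal_pow_simps graded_ideal_prod assms)
qed

lemma ideal_pow_Suc_subset:
  assumes "graded_ideal d I"
  shows "I [^]\<^bsub>ideals_set (mpoly_ring d)\<^esub> Suc n \<subseteq> I [^]\<^bsub>ideals_set (mpoly_ring d)\<^esub> n"
proof -
  interpret cring "mpoly_ring d" by (rule cring_mpoly_ring)
  show ?thesis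
    using ideal_prod_inter[of "I [^]\<^bsub>ideals_set (mpoly_ring d)\<^esub> n" I] assms graded_ideal_pow[OF assms, of n]
    by (simp add: ideal_pow_simps graded_ideal_def)
qed

text \<open>Induction with the product rule: for \<open>p\<close> in the power and \<open>q\<close> in \<open>I\<close>, the term
  \<open>(\<partial>p) q\<close> lies in the right power by induction and \<open>p (\<partial>q)\<close> because \<open>p\<close> does
  already.\<close>

lemma partial_deriv_ideal_pow:
  assumes I: "graded_ideal d I" and "f \<in> I [^]\<^bsub>ideals_set (mpoly_ring d)\<^esub> Suc n"
  shows "partial_deriv j f \<in> I [^]\<^bsub>ideals_set (mpoly_ring d)\<^esub> n"
  using assms(2)
proof (induction n arbitrary: f)
  case 0
  have "f \<in> carrier (mpoly_ring d)"
    using 0 graded_ideal_pow[OF I, of "Suc 0"] mpoly_ideal_carrier by (auto simp: graded_ideal_def)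
  then show ?case by (simp add: ideal_pow_simps mpoly_carrier_partial_deriv)
next
  case (Suc n)
  let ?P = "\<lambda>n. I [^]\<^bsub>ideals_set (mpoly_ring d)\<^esub> (n::nat)"
  have id: "ideal (?P m) (mpoly_ring d)" for m using graded_ideal_pow[OF I] by (simp add: graded_ideal_def)
  have "f \<in> ?P (Suc n) \<cdot>\<^bsub>mpoly_ring d\<^esub> I" using Suc.prems by (subst ideal_pow_simps(4)[symmetric])
  then show ?case
  proof (induction rule: ideal_prod.induct)
    case (prod p q)
    have "partial_deriv j p * q \<in> ?P (Suc n)"
      using ideal_prod.prod[of "partial_deriv j p" "?P n" q I "mpoly_ring d"] Suc.IH[OF prod(1)] prod(2)
      by (simp add: ideal_pow_simps)
    moreover have "partial_deriv j q * p \<in> ?P (Suc n)"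
    proof (rule mpoly_ideal_mult[OF id prod(1)])
      have "q \<in> carrier (mpoly_ring d)" using I prod(2) mpoly_ideal_carrier by (auto simp: graded_ideal_def)
      then show "partial_deriv j q \<in> carrier (mpoly_ring d)" by (rule mpoly_carrier_partial_deriv)
    qed
    ultimately have "partial_deriv j p * q + partial_deriv j q * p \<in> ?P (Suc n)"
      by (rule mpoly_ideal_add[OF id])
    then show ?case unfolding mpoly_ring_simps partial_deriv_mult by (simp only: mult.commute)
  next
    case (sum f g)
    then show ?case unfolding mpoly_ring_simps partial_deriv_add by (intro mpoly_ideal_add[OF id])
  qed
qed

theorem proposition3p5:
  fixes d :: nat
    and P :: "nat \<Rightarrow> (('k::field_char_0) mpoly, 'c) module"
    and \<delta> :: "nat \<Rightarrow> 'c \<Rightarrow> 'c"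
    and \<epsilon> :: "'c \<Rightarrow> 'k mpoly set"
  assumes "free_resolution (mpoly_ring d) (residue_module d) P \<delta> \<epsilon>"
  shows "(\<forall>I J. graded_ideal d I \<and> graded_ideal d J \<and> I \<subseteq> J \<and> deriv_ideal d I \<subseteq> J \<longrightarrow>
            (\<forall>i>0. Tor_surj_zero d P \<delta> I J i)) \<and>
         (\<forall>I. graded_ideal d I \<and> I \<noteq> carrier (mpoly_ring d) \<longrightarrow> rho d P \<delta> I = 1)"
proof (intro conjI allI impI)
  have Tor_zero: "Tor_surj_zero d P \<delta> I J i"
    if "graded_ideal d I" "graded_ideal d J" "I \<subseteq> J" "deriv_ideal d I \<subseteq> J" "i > 0" for I J i
    using Tor_surj_zero_if_deriv[OF assms that(1) _ that(3,4), of "i - 1"] that(2,5)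
    by (simp add: graded_ideal_def)
  show "Tor_surj_zero d P \<delta> I J i"
    if "graded_ideal d I \<and> graded_ideal d J \<and> I \<subseteq> J \<and> deriv_ideal d I \<subseteq> J" "0 < i" for I J i
    using that Tor_zero by blast
  fix I :: "'k mpoly set" assume "graded_ideal d I \<and> I \<noteq> carrier (mpoly_ring d)"
  then have I: "graded_ideal d I" ..
  interpret cring "mpoly_ring d :: 'k mpoly ring" by (rule cring_mpoly_ring)
  let ?P = "\<lambda>n. I [^]\<^bsub>ideals_set (mpoly_ring d)\<^esub> (n::nat)"
  have "Tor_surj_zero d P \<delta> (?P r) (?P (r - 1)) i" if "r > 1" "i > 0" for r i
  proof -
    have r: "r = Suc (r - 1)" using that by simp
    have "deriv_ideal d (?P (Suc (r - 1))) \<subseteq> ?P (r - 1)"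
      unfolding deriv_ideal_def
      by (rule genideal_minimal)
         (use graded_ideal_pow[OF I] partial_deriv_ideal_pow[OF I] in \<open>auto simp: graded_ideal_def\<close>)
    then show ?thesis
      by (subst r) (intro Tor_zero graded_ideal_pow ideal_pow_Suc_subset I that(2))
  qed
  then show "rho d P \<delta> I = 1"
    unfolding rho_def by (intro Least_equality) auto
qed

end
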